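(* Let $C \subset \mathbb{P}^{2}_{\mathbb{C}}$ be a reduced curve of even degree $n \geq 8$ which is nodal, i.e., $C$ has only $A_1$ singularities. Then $C$ is not an MK-curve.
   Context: ADE singularities of plane curves are those locally analytically equivalent to $A_k: x^2+y^{k+1}=0$ ($k\ge 1$), $D_k: x^2y+y^{k-1}=0$ ($k\geq 4$), $E_6: x^3+y^4=0$, $E_7: x^3+xy^3=0$, $E_8: x^3+y^5=0$. Let $C$ be a reduced plane curve of even degree with only ADE singularities, and let $X$ be the double cover of $\mathbb{P}^2_{\mathbb{C}}$ branched along $C$. Over each $p\in \mathrm{Sing}(C)$, $X$ has a rational double point of the same type. The Miyaoka-Kobayashi number of $p$ is $m(p)=3\left(e(E_p)-\frac{1}{\mathrm{ord}(G_p)}\right)-K(E_p)^2$, where $E_p$ is the exceptional curve over $p$ in the minimal resolution of $X$, $e$ is the topological Euler characteristic, $G_p$ is the associated small group, and $K(E_p)$ is the local canonical divisor (which is zero for rational double points). Explicitly, $m(A_k)=3(k+1)-\frac{3}{k+1}$ for $k\ge 1$, $m(D_k)=3(k+1)-\frac{3}{4(k-2)}$ for $k\ge 4$, $m(E_6)=\frac{167}{8}$, $m(E_7)=\frac{383}{16}$, $m(E_8)=\frac{1079}{40}$. Put $m(C)=\sum_{p\in \mathrm{Sing}(C)}m(p)$. MK-curve: a reduced curve $C\subset\mathbb{P}^2_{\mathbb{C}}$ of even degree $n\geq 6$ with only ADE singularities such that $m(C)=\frac{n}{2}(5n-6)$. *)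

theory Defs
  imports "HOL-Analysis.Analysis" "HOL-Computational_Algebra.Computational_Algebra"
begin

section \<open>Forms in three variables and plane curves\<close>

text \<open>
  The ring \<open>\<complex>[x,y,z]\<close> is represented as \<open>\<complex>[x][y][z]\<close>: the innermost polynomial variable is \<open>x\<close>,
  the outermost one is \<open>z\<close>.  A point \<open>v\<close> of \<open>\<complex>\<^sup>3\<close> has coordinates \<open>x = v $ 1\<close>, \<open>y = v $ 2\<close>,
  \<open>z = v $ 3\<close>.
\<close>

type_synonym poly3 = "complex poly poly poly"

definition eval3 :: "poly3 \<Rightarrow> complex ^ 3 \<Rightarrow> complex" where
  "eval3 F v = poly (poly (poly F [:[:v $ 3:]:]) [:v $ 2:]) (v $ 1)"

definition homogeneous3 :: "nat \<Rightarrow> poly3 \<Rightarrow> bool" where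
  "homogeneous3 n F \<longleftrightarrow> (\<forall>i j k. coeff (coeff (coeff F k) j) i \<noteq> 0 \<longrightarrow> i + j + k = n)"

definition partial_x :: "poly3 \<Rightarrow> poly3" where
  "partial_x = map_poly (map_poly pderiv)"

definition partial_y :: "poly3 \<Rightarrow> poly3" where
  "partial_y = map_poly pderiv"

definition partial_z :: "poly3 \<Rightarrow> poly3" where
  "partial_z = pderiv"

text \<open>
  A reduced curve of degree \<open>n\<close> in the complex projective plane is given by its equation, a
  square-free form of degree \<open>n\<close> (unique up to a nonzero constant).  The zero polynomial is not
  square-free.
\<close>

definition reduced_plane_curve :: "nat \<Rightarrow> poly3 \<Rightarrow> bool" where
  "reduced_plane_curve n F \<longleftrightarrow> n \<ge> 1 \<and> homogeneous3 n F \<and> squarefree F"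

text \<open>Points of the projective plane are the lines through the origin of \<open>\<complex>\<^sup>3\<close>.\<close>

definition proj_point :: "complex ^ 3 \<Rightarrow> (complex ^ 3) set" where
  "proj_point v = vec.span {v}"

definition Sing :: "poly3 \<Rightarrow> (complex ^ 3) set set" where
  "Sing F = {proj_point v | v. v \<noteq> 0 \<and> eval3 F v = 0 \<and>
     eval3 (partial_x F) v = 0 \<and> eval3 (partial_y F) v = 0 \<and> eval3 (partial_z F) v = 0}"


section \<open>Local analytic equivalence\<close>

text \<open>
  Holomorphy of a function of two complex variables on an open set: the Frechet derivative exists
  and is complex linear at every point.
\<close>

definition holomorphic2_on :: "(complex \<times> complex \<Rightarrow> complex) \<Rightarrow> (complex \<times> complex) set \<Rightarrow> bool"
  where "holomorphic2_on f U \<longleftrightarrow>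
    (\<forall>p\<in>U. \<exists>a b. (f has_derivative (\<lambda>h. a * fst h + b * snd h)) (at p))"

definition biholomorphism ::
  "(complex \<times> complex) set \<Rightarrow> (complex \<times> complex) set \<Rightarrow>
   (complex \<times> complex \<Rightarrow> complex \<times> complex) \<Rightarrow> (complex \<times> complex \<Rightarrow> complex \<times> complex) \<Rightarrow> bool"
  where "biholomorphism U V \<phi> \<psi> \<longleftrightarrow>
    open U \<and> open V \<and> homeomorphism U V \<phi> \<psi> \<and>
    holomorphic2_on (fst \<circ> \<phi>) U \<and> holomorphic2_on (snd \<circ> \<phi>) U \<and>
    holomorphic2_on (fst \<circ> \<psi>) V \<and> holomorphic2_on (snd \<circ> \<psi>) V"

text \<open>
  The germs at the origin of the analytic curves \<open>f = 0\<close> and \<open>g = 0\<close> are isomorphic: a local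
  biholomorphic change of coordinates identifies the ideals generated by \<open>f\<close> and \<open>g\<close>, that is,
  \<open>f\<close> and \<open>g \<circ> \<phi>\<close> differ by a holomorphic unit.
\<close>

definition locally_analytically_equivalent ::
  "(complex \<times> complex \<Rightarrow> complex) \<Rightarrow> (complex \<times> complex \<Rightarrow> complex) \<Rightarrow> bool"
  where "locally_analytically_equivalent f g \<longleftrightarrow>
    (\<exists>U V \<phi> \<psi> u. biholomorphism U V \<phi> \<psi> \<and> (0, 0) \<in> U \<and> \<phi> (0, 0) = (0, 0) \<and>
       holomorphic2_on u U \<and> (\<forall>p\<in>U. u p \<noteq> 0 \<and> f p = u p * g (\<phi> p)))"


section \<open>ADE singularities\<close>

datatype ade_type = type_A nat | type_D nat | type_E6 | type_E7 | type_E8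

fun valid_ade :: "ade_type \<Rightarrow> bool" where
  "valid_ade (type_A k) \<longleftrightarrow> k \<ge> 1"
| "valid_ade (type_D k) \<longleftrightarrow> k \<ge> 4"
| "valid_ade type_E6 \<longleftrightarrow> True"
| "valid_ade type_E7 \<longleftrightarrow> True"
| "valid_ade type_E8 \<longleftrightarrow> True"

fun ade_normal_form :: "ade_type \<Rightarrow> complex \<times> complex \<Rightarrow> complex" where
  "ade_normal_form (type_A k) (x, y) = x ^ 2 + y ^ (k + 1)"
| "ade_normal_form (type_D k) (x, y) = x ^ 2 * y + y ^ (k - 1)"
| "ade_normal_form type_E6 (x, y) = x ^ 3 + y ^ 4"
| "ade_normal_form type_E7 (x, y) = x ^ 3 + x * y ^ 3"
| "ade_normal_form type_E8 (x, y) = x ^ 3 + y ^ 5"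

text \<open>
  If \<open>v\<close>, \<open>a\<close>, \<open>b\<close> is a basis of \<open>\<complex>\<^sup>3\<close>, then \<open>(s, t) \<mapsto> [v + s a + t b]\<close> is an affine chart of the
  projective plane centred at \<open>[v]\<close>, in which the curve \<open>F = 0\<close> has the equation
  \<open>local_equation F v a b = 0\<close>.  The local isomorphism class does not depend on the chart.
\<close>

definition local_equation ::
  "poly3 \<Rightarrow> complex ^ 3 \<Rightarrow> complex ^ 3 \<Rightarrow> complex ^ 3 \<Rightarrow> complex \<times> complex \<Rightarrow> complex"
  where "local_equation F v a b = (\<lambda>(s, t). eval3 F (v + s *s a + t *s b))"

definition has_ade_type :: "poly3 \<Rightarrow> (complex ^ 3) set \<Rightarrow> ade_type \<Rightarrow> bool" where
  "has_ade_type F P T \<longleftrightarrow> valid_ade T \<and>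
     (\<exists>v a b. P = proj_point v \<and> det (vector [v, a, b] :: complex ^ 3 ^ 3) \<noteq> 0 \<and>
        locally_analytically_equivalent (local_equation F v a b) (ade_normal_form T))"

definition only_ade_singularities :: "poly3 \<Rightarrow> bool" where
  "only_ade_singularities F \<longleftrightarrow> (\<forall>P\<in>Sing F. \<exists>T. has_ade_type F P T)"

definition nodal :: "poly3 \<Rightarrow> bool" where
  "nodal F \<longleftrightarrow> (\<forall>P\<in>Sing F. has_ade_type F P (type_A 1))"


section \<open>Miyaoka--Kobayashi numbers and MK-curves\<close>

text \<open>
  Over a point of type \<open>T\<close> the double cover of the plane has a rational double point of type \<open>T\<close>.
  Its exceptional curve is a tree of \<open>k\<close> smooth rational curves, \<open>k\<close> being the index of \<open>T\<close>, so
  that its Euler number is \<open>2 k - (k - 1) = k + 1\<close>.  Its small group is the corresponding finite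
  subgroup of \<open>SL(2, \<complex>)\<close>: cyclic, binary dihedral, binary tetrahedral, octahedral or icosahedral.
\<close>

fun exceptional_euler :: "ade_type \<Rightarrow> nat" where
  "exceptional_euler (type_A k) = k + 1"
| "exceptional_euler (type_D k) = k + 1"
| "exceptional_euler type_E6 = 7"
| "exceptional_euler type_E7 = 8"
| "exceptional_euler type_E8 = 9"

fun small_group_order :: "ade_type \<Rightarrow> nat" where
  "small_group_order (type_A k) = k + 1"
| "small_group_order (type_D k) = 4 * (k - 2)"
| "small_group_order type_E6 = 24"
| "small_group_order type_E7 = 48"
| "small_group_order type_E8 = 120"

text \<open>The term \<open>K(E)\<^sup>2\<close> of the general definition vanishes for rational double points.\<close>

definition mk_number :: "ade_type \<Rightarrow> real" where
  "mk_number T = 3 * (real (exceptional_euler T) - 1 / real (small_group_order T))"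

lemma mk_number_explicit:
  "k \<ge> 1 \<Longrightarrow> mk_number (type_A k) = 3 * (real k + 1) - 3 / (real k + 1)"
  "k \<ge> 4 \<Longrightarrow> mk_number (type_D k) = 3 * (real k + 1) - 3 / (4 * (real k - 2))"
  "mk_number type_E6 = 167 / 8"
  "mk_number type_E7 = 383 / 16"
  "mk_number type_E8 = 1079 / 40"
  by (auto simp: mk_number_def of_nat_diff field_simps)

definition mk_number_at :: "poly3 \<Rightarrow> (complex ^ 3) set \<Rightarrow> real" where
  "mk_number_at F P = mk_number (THE T. has_ade_type F P T)"

definition mk_number_curve :: "poly3 \<Rightarrow> real" where
  "mk_number_curve F = (\<Sum>P\<in>Sing F. mk_number_at F P)"

definition MK_curve :: "poly3 \<Rightarrow> bool" where
  "MK_curve F \<longleftrightarrow> (\<exists>n. reduced_plane_curve n F \<and> even n \<and> n \<ge> 6 \<and>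
     only_ade_singularities F \<and> mk_number_curve F = real n / 2 * (5 * real n - 6))"

end

theory Submission
  imports Defs "HOL-Computational_Algebra.Field_as_Ring" "Subresultants.Subresultant_Gcd"
begin

text \<open>
  A node contributes \<open>9/2\<close> to \<open>m(C)\<close>, so a nodal MK-curve of degree \<open>n\<close> has \<open>n (5 n - 6) / 9\<close>
  nodes. This exceeds \<open>n (n - 1) / 2\<close>, the maximal number of singular points of a reduced curve of
  degree \<open>n\<close>. For this bound, choose projective coordinates so general that \<open>F\<close> is monic in \<open>z\<close> (up
  to a constant) and the singular points have distinct projections \<open>(x : y)\<close>. The discriminant
  \<open>Res\<^sub>z(F, F\<^sub>z) = A F + B F\<^sub>z\<close> is a nonzero form of degree \<open>n (n - 1)\<close>, and every singular point
  projects to a double root of it: \<open>F\<close> vanishes to second order there, and both \<open>B\<close> and \<open>F\<^sub>z\<close>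
  vanish.

  That the number attached to a node is the one of \<open>A\<^sub>1\<close> requires that a singularity is not at the
  same time of type \<open>A\<^sub>1\<close> and of another type: the quadratic part of the local equation
  is nondegenerate for \<open>A\<^sub>1\<close> only.
\<close>

no_notation vec_index (infixl "$" 100)
no_notation fps_nth (infixl "$" 75)
hide_const (open) Matrix.mat Determinant.det

section \<open>Evaluation and linear substitution of forms\<close>

lemma comm_ring_hom_comp:
  assumes "comm_ring_hom f" "comm_ring_hom g"
  shows "comm_ring_hom (\<lambda>x. f (g x))"
proof -
  interpret f: comm_ring_hom f by fact
  interpret g: comm_ring_hom g by fact
  show ?thesis by unfold_locales (simp_all add: f.hom_add g.hom_add f.hom_mult g.hom_mult)
qed

lemma comm_ring_hom_eval_poly:
  assumes "comm_ring_hom h"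
  shows "comm_ring_hom (\<lambda>p. poly (map_poly h p) X)"
proof -
  interpret h: comm_ring_hom h by fact
  interpret m: map_poly_comm_ring_hom h ..
  show ?thesis by unfold_locales (simp_all add: m.hom_add m.hom_mult)
qed

text \<open>The target ring is left arbitrary so that one notion covers values at points
  (\<open>eval3\<close>), restrictions to lines (\<open>line3\<close>) and linear substitutions
  (\<open>subst3\<close>).\<close>

definition ev3 :: "(complex \<Rightarrow> 'a::comm_ring_1) \<Rightarrow> 'a \<Rightarrow> 'a \<Rightarrow> 'a \<Rightarrow> poly3 \<Rightarrow> 'a" where
  "ev3 h X Y Z F =
     poly (map_poly (\<lambda>q. poly (map_poly (\<lambda>r. poly (map_poly h r) X) q) Y) F) Z"

abbreviation const3 :: "complex \<Rightarrow> poly3" where "const3 c \<equiv> [:[:[:c:]:]:]"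
abbreviation var_x :: poly3 where "var_x \<equiv> [:[:[:0, 1:]:]:]"
abbreviation var_y :: poly3 where "var_y \<equiv> [:[:0, 1:]:]"
abbreviation var_z :: poly3 where "var_z \<equiv> [:0, 1:]"

lemma comm_ring_hom_ev3: "comm_ring_hom h \<Longrightarrow> comm_ring_hom (ev3 h X Y Z)"
  unfolding ev3_def by (intro comm_ring_hom_eval_poly)

lemma ev3_generators:
  assumes "comm_ring_hom h"
  shows "ev3 h X Y Z (const3 c) = h c" "ev3 h X Y Z var_x = X"
    "ev3 h X Y Z var_y = Y" "ev3 h X Y Z var_z = Z"
proof -
  interpret h: comm_ring_hom h by fact
  interpret h2: comm_ring_hom "\<lambda>r. poly (map_poly h r) X"
    by (rule comm_ring_hom_eval_poly) fact
  interpret h3: comm_ring_hom "\<lambda>q. poly (map_poly (\<lambda>r. poly (map_poly h r) X) q) Y"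
    by (rule comm_ring_hom_eval_poly) unfold_locales
  show "ev3 h X Y Z (const3 c) = h c" "ev3 h X Y Z var_x = X"
    "ev3 h X Y Z var_y = Y" "ev3 h X Y Z var_z = Z"
    by (simp_all add: ev3_def h.map_poly_pCons_hom h2.map_poly_pCons_hom h3.map_poly_pCons_hom)
qed

text \<open>Constants and the three variables generate the ring, by Horner's scheme on each of the
  three levels. Identities between homomorphisms can then be checked on generators.\<close>

lemma poly3_induct [case_names const x y z add mult]:
  assumes c: "\<And>c. P (const3 c)" and x: "P var_x" and y: "P var_y" and z: "P var_z"
    and add: "\<And>F G. P F \<Longrightarrow> P G \<Longrightarrow> P (F + G)"
    and mult: "\<And>F G. P F \<Longrightarrow> P G \<Longrightarrow> P (F * G)"
  shows "P F"
proof -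
  have zero: "P 0" using c[of 0] by simp
  have 1: "P [:[:r:]:]" for r
  proof (induction r)
    case (pCons a r)
    have "[:[:pCons a r:]:] = const3 a + var_x * [:[:r:]:]" by simp
    then show ?case using c x add mult pCons by metis
  qed (use zero in simp)
  have 2: "P [:q:]" for q
  proof (induction q)
    case (pCons r q)
    have "[:pCons r q:] = [:[:r:]:] + var_y * [:q:]" by simp
    then show ?case using 1 y add mult pCons by metis
  qed (use zero in simp)
  show ?thesis
  proof (induction F)
    case (pCons q F)
    have "pCons q F = [:q:] + var_z * F" by simp
    then show ?case using 2 z add mult pCons by metis
  qed (use zero in simp)
qed

lemma poly3_hom_eqI:
  assumes "comm_ring_hom f" "comm_ring_hom g"
    and "\<And>c. f (const3 c) = g (const3 c)" "f var_x = g var_x" "f var_y = g var_y"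
    "f var_z = g var_z"
  shows "f F = g F"
proof -
  interpret f: comm_ring_hom f by fact
  interpret g: comm_ring_hom g by fact
  show ?thesis
    by (induction F rule: poly3_induct) (simp_all only: assms f.hom_add g.hom_add f.hom_mult g.hom_mult)
qed

lemma hom_ev3:
  assumes f: "comm_ring_hom f" and h: "comm_ring_hom h"
  shows "f (ev3 h X Y Z F) = ev3 (\<lambda>c. f (h c)) (f X) (f Y) (f Z) F"
proof -
  note fh = comm_ring_hom_comp[OF f h]
  show ?thesis
    by (rule poly3_hom_eqI[OF comm_ring_hom_comp[OF f comm_ring_hom_ev3[OF h]] comm_ring_hom_ev3[OF fh]])
      (simp_all only: ev3_generators[OF h] ev3_generators[OF fh])
qed

lemma comm_ring_hom_poly: "comm_ring_hom (\<lambda>p. poly p a)"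
  by unfold_locales

lemma comm_ring_hom_id: "comm_ring_hom (\<lambda>x. x)"
  by unfold_locales auto

lemma comm_ring_hom_pCons: "comm_ring_hom (\<lambda>c. [:c:])"
  by unfold_locales auto

lemma comm_ring_hom_const3: "comm_ring_hom const3"
  by unfold_locales auto

lemma comm_ring_hom_eval3: "comm_ring_hom (\<lambda>F. eval3 F v)"
  unfolding eval3_def by (rule comm_ring_hom_comp[OF comm_ring_hom_poly
      comm_ring_hom_comp[OF comm_ring_hom_poly comm_ring_hom_poly]])

lemma eval3_eq_ev3: "eval3 F v = ev3 (\<lambda>c. c) (v $ 1) (v $ 2) (v $ 3) F"
  by (rule poly3_hom_eqI[OF comm_ring_hom_eval3 comm_ring_hom_ev3[OF comm_ring_hom_id]])
    (simp_all only: ev3_generators[OF comm_ring_hom_id], simp_all add: eval3_def)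

lemma poly_map_poly_altdef:
  fixes g :: "'b::comm_ring_1 \<Rightarrow> 'a::comm_ring_1"
  assumes "comm_ring_hom g"
  shows "poly (map_poly g p) a = (\<Sum>i\<le>degree p. g (coeff p i) * a ^ i)"
proof -
  interpret g: comm_ring_hom g by fact
  show ?thesis
    using eval_poly_as_sum[of g p a] by (simp add: eval_poly_def mult.commute)
qed

text \<open>Homogeneity is a condition on coefficients, so it has to be exploited on an explicit sum
  of monomials.\<close>

lemma ev3_altdef:
  assumes "comm_ring_hom h"
  shows "ev3 h X Y Z F =
    (\<Sum>k\<le>degree F. (\<Sum>j\<le>degree (coeff F k).
      (\<Sum>i\<le>degree (coeff (coeff F k) j). h (coeff (coeff (coeff F k) j) i) * X ^ i) * Y ^ j) * Z ^ k)"
  unfolding ev3_def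
    poly_map_poly_altdef[OF comm_ring_hom_eval_poly[OF comm_ring_hom_eval_poly[OF assms]]]
  unfolding poly_map_poly_altdef[OF comm_ring_hom_eval_poly[OF assms]]
  unfolding poly_map_poly_altdef[OF assms] ..

lemma ev3_homogeneous:
  assumes h: "comm_ring_hom h" and F: "homogeneous3 n F"
  shows "ev3 h (t * X) (t * Y) (t * Z) F = t ^ n * ev3 h X Y Z F"
proof -
  interpret h: comm_ring_hom h by fact
  have term_eq: "h (coeff (coeff (coeff F k) j) i) * (t * X) ^ i * (t * Y) ^ j * (t * Z) ^ k =
      t ^ n * (h (coeff (coeff (coeff F k) j) i) * X ^ i * Y ^ j * Z ^ k)" for i j k
  proof (cases "coeff (coeff (coeff F k) j) i = 0")
    case False
    then have "n = i + j + k" using F by (auto simp: homogeneous3_def)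
    then show ?thesis by (simp add: power_mult_distrib power_add mult_ac)
  qed simp
  show ?thesis
    unfolding ev3_altdef[OF h] sum_distrib_left sum_distrib_right
    by (rule sum.cong[OF refl], rule sum.cong[OF refl], rule sum.cong[OF refl], rule term_eq)
qed

section \<open>Linear forms and linear changes of coordinates\<close>

definition linear_form :: "complex ^ 3 \<Rightarrow> poly3" where
  "linear_form c = [:[:[:0, c $ 1:], [:c $ 2:]:], [:[:c $ 3:]:]:]"

lemma linear_form_altdef:
  "linear_form c = const3 (c $ 1) * var_x + const3 (c $ 2) * var_y + const3 (c $ 3) * var_z"
  by (simp add: linear_form_def)

lemma ev3_linear_form:
  assumes h: "comm_ring_hom h"
  shows "ev3 h X Y Z (linear_form c) = h (c $ 1) * X + h (c $ 2) * Y + h (c $ 3) * Z"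
proof -
  interpret e: comm_ring_hom "ev3 h X Y Z" using h by (rule comm_ring_hom_ev3)
  show ?thesis
    unfolding linear_form_altdef by (simp only: e.hom_add e.hom_mult ev3_generators[OF h])
qed

lemma linear_form_eq_0_iff: "linear_form c = 0 \<longleftrightarrow> c = 0"
  by (auto simp: linear_form_def Finite_Cartesian_Product.vec_eq_iff forall_3)

definition subst3 :: "complex ^ 3 ^ 3 \<Rightarrow> poly3 \<Rightarrow> poly3" where
  "subst3 M = ev3 const3 (linear_form (M $ 1)) (linear_form (M $ 2)) (linear_form (M $ 3))"

lemma comm_ring_hom_subst3: "comm_ring_hom (subst3 M)"
  unfolding subst3_def by (intro comm_ring_hom_ev3 comm_ring_hom_const3)

lemma ev3_subst3:
  assumes h: "comm_ring_hom h"
  shows "ev3 h X Y Z (subst3 M F) =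
    ev3 h (h (M $ 1 $ 1) * X + h (M $ 1 $ 2) * Y + h (M $ 1 $ 3) * Z)
      (h (M $ 2 $ 1) * X + h (M $ 2 $ 2) * Y + h (M $ 2 $ 3) * Z)
      (h (M $ 3 $ 1) * X + h (M $ 3 $ 2) * Y + h (M $ 3 $ 3) * Z) F"
  unfolding subst3_def
  by (subst hom_ev3[OF comm_ring_hom_ev3[OF h] comm_ring_hom_const3])
    (simp only: ev3_generators[OF h] ev3_linear_form[OF h])

lemma eval3_subst3: "eval3 (subst3 M F) v = eval3 F (M *v v)"
  unfolding eval3_eq_ev3
  by (simp add: ev3_subst3[OF comm_ring_hom_id] matrix_vector_mult_def sum_3)

text \<open>Substitution is pullback along the linear map, hence the reversed order of the matrix
  product.\<close>

lemma subst3_subst3: "subst3 M (subst3 N F) = subst3 (N ** M) F"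
proof -
  have lin: "const3 a * linear_form (M $ 1) + const3 b * linear_form (M $ 2) + const3 c * linear_form (M $ 3)
      = linear_form (\<chi> j. a * M $ 1 $ j + b * M $ 2 $ j + c * M $ 3 $ j)" for a b c
    by (simp add: linear_form_def algebra_simps)
  have row: "(N ** M) $ i = (\<chi> j. N $ i $ 1 * M $ 1 $ j + N $ i $ 2 * M $ 2 $ j + N $ i $ 3 * M $ 3 $ j)"
    for i
    by (simp add: matrix_matrix_mult_def sum_3 Finite_Cartesian_Product.vec_eq_iff)
  show ?thesis
    unfolding subst3_def[of M] ev3_subst3[OF comm_ring_hom_const3] lin row[symmetric]
    by (simp add: subst3_def)
qed

lemma subst3_1: "subst3 (mat 1) F = F"
  by (rule poly3_hom_eqI[OF comm_ring_hom_subst3 comm_ring_hom_id])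
    (simp_all only: subst3_def ev3_generators[OF comm_ring_hom_const3],
      simp_all add: linear_form_def Finite_Cartesian_Product.mat_def)

text \<open>Substituting the inverse matrix inverts the substitution, so square divisors and units
  can be carried back and forth.\<close>

lemma squarefree_subst3:
  assumes "invertible M" "squarefree F"
  shows "squarefree (subst3 M F)"
proof -
  obtain N where N: "M ** N = mat 1" "N ** M = mat 1"
    using assms by (auto simp: invertible_def)
  interpret m: comm_ring_hom "subst3 M" by (rule comm_ring_hom_subst3)
  interpret n: comm_ring_hom "subst3 N" by (rule comm_ring_hom_subst3)
  show ?thesis
  proof (rule squarefreeI)
    fix G assume "G ^ 2 dvd subst3 M F"
    then have "subst3 N (G ^ 2) dvd subst3 N (subst3 M F)" by (rule n.hom_dvd)
    then have "(subst3 N G) ^ 2 dvd F" by (simp add: subst3_subst3 N subst3_1 n.hom_power)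
    then have "subst3 N G dvd 1" using assms squarefreeD by blast
    then have "subst3 M (subst3 N G) dvd 1" using m.hom_dvd[of _ 1] by simp
    then show "G dvd 1" by (simp add: subst3_subst3 N subst3_1)
  qed
qed

section \<open>The discriminant\<close>

text \<open>The matrix \<open>subresultant_mat 0 f g\<close> has the resultant as its determinant,
  like the Sylvester matrix, but its last row has polynomial entries. The degree assumption makes
  sure that there is a last row.\<close>

lemma resultant_in_ideal:
  fixes f g :: "'a::{idom} poly"
  assumes "degree f + degree g > 0"
  shows "\<exists>A B. [:resultant f g:] = A * f + B * g"
proof -
  define n where "n = degree f + degree g"
  define M where "M = subresultant_mat 0 f g"
  have M: "M \<in> carrier_mat n n"
    unfolding M_def n_def by (intro carrier_matI) simp_all
  define A where "A = (\<Sum>j<degree g. monom 1 (degree g - 1 - j) * cofactor M (n - 1) j)"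
  define B where "B = (\<Sum>j\<in>{degree g..<n}. monom 1 (degree f - 1 - (j - degree g)) * cofactor M (n - 1) j)"
  \<comment> \<open>The last row of \<open>M\<close> consists of multiples of \<open>f\<close> and \<open>g\<close>: expand along it.\<close>
  have "[:resultant f g:] = Determinant.det M"
    by (simp add: M_def subresultant_resultant flip: subresultant_def)
  also have "\<dots> = (\<Sum>j<n. M $$ (n - 1, j) * cofactor M (n - 1) j)"
    using M assms by (intro laplace_expansion_row) (auto simp: n_def)
  also have "{..<n} = {..<degree g} \<union> {degree g..<n}"
    by (auto simp: n_def)
  also have "(\<Sum>j\<in>{..<degree g} \<union> {degree g..<n}. M $$ (n - 1, j) * cofactor M (n - 1) j) =
     (\<Sum>j<degree g. M $$ (n - 1, j) * cofactor M (n - 1) j) +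
     (\<Sum>j\<in>{degree g..<n}. M $$ (n - 1, j) * cofactor M (n - 1) j)"
    by (intro sum.union_disjoint) auto
  also have "(\<Sum>j<degree g. M $$ (n - 1, j) * cofactor M (n - 1) j) = A * f"
    unfolding A_def sum_distrib_right
    using assms by (intro sum.cong) (auto simp: M_def subresultant_index_mat n_def mult_ac)
  also have "(\<Sum>j\<in>{degree g..<n}. M $$ (n - 1, j) * cofactor M (n - 1) j) = B * g"
    unfolding B_def sum_distrib_right
    using assms by (intro sum.cong) (auto simp: M_def subresultant_index_mat n_def mult_ac Let_def)
  finally show ?thesis by blast
qed

text \<open>The assumption bounds the total degree of \<open>f\<close> in the inner and outer
  variables, and the resultant eliminates the outer one. In the application \<open>x\<close> belongs
  to the coefficients, so the degree in \<open>y\<close> is bounded.\<close>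

lemma degree_resultant_pderiv_le:
  fixes f :: "'a::{idom,ring_char_0} poly poly"
  assumes deg: "degree f = n" and f: "\<And>k. coeff f k \<noteq> 0 \<Longrightarrow> degree (coeff f k) + k \<le> n"
  shows "degree (resultant f (pderiv f)) \<le> n * (n - 1)"
proof -
  define N where "N = n + (n - 1)"
  define S where "S = sylvester_mat f (pderiv f)"
  have dp: "degree (pderiv f) = n - 1" by (simp add: Polynomial.degree_pderiv deg)
  have S: "S \<in> carrier_mat N N" unfolding S_def N_def
    by (intro carrier_matI) (simp_all add: deg dp)
  \<comment> \<open>Giving row \<open>i\<close> the weight \<open>- e i\<close> and column \<open>j\<close> the weight \<open>j\<close> bounds the degree of
    each entry of \<open>S\<close> by the total weight of its position.\<close>
  define e where "e i = (if i < n - 1 then i else i - (n - 1))" for i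
  \<comment> \<open>Differentiating in the outer variable lowers the total degree by one.\<close>
  have pd: "degree (coeff (pderiv f) k) + k \<le> n - 1" if "coeff (pderiv f) k \<noteq> 0" for k
  proof -
    have "coeff f (Suc k) \<noteq> 0" using that by (auto simp: coeff_pderiv)
    moreover have "degree (coeff (pderiv f) k) \<le> degree (coeff f (Suc k))"
      unfolding coeff_pderiv by (metis degree_of_nat degree_mult_le add_0)
    ultimately show ?thesis using f[of "Suc k"] by linarith
  qed
  have entry: "degree (S $$ (i, j)) + e i \<le> j" if "i < N" "j < N" "S $$ (i, j) \<noteq> 0" for i j
  proof -
    have *: "S $$ (i, j) = (if i < n - 1 then if i \<le> j \<and> j - i \<le> n then coeff f (n + i - j) else 0
         else if i - (n - 1) \<le> j \<and> j \<le> i then coeff (pderiv f) (i - j) else 0)"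
      using that sylvester_index_mat[of i f "pderiv f" j] by (simp add: S_def N_def deg dp)
    show ?thesis
      using that f[of "n + i - j"] pd[of "i - j"] unfolding * e_def
      by (auto split: if_splits)
  qed
  \<comment> \<open>The \<open>n - 1\<close> rows of \<open>f\<close> and the \<open>n\<close> rows
    of its derivative are each numbered from 0 by \<open>e\<close>, so the column weights exceed the
    row weights by exactly \<open>n * (n - 1)\<close>.\<close>
  have sum_e: "(\<Sum>i<N. e i) + n * (n - 1) = (\<Sum>j<N. j)"
  proof (cases n)
    case (Suc m)
    have A: "(\<Sum>i<m + k. e i) = (\<Sum>i<m. i) + (\<Sum>i<k. i)" for k
      by (induction k) (auto simp: e_def Suc)
    have B: "(\<Sum>j<m + k. j) = (\<Sum>i<m. i) + (\<Sum>i<k. i) + k * m" for k :: nat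
      by (induction k) (auto simp: algebra_simps)
    have N: "N = m + n" by (simp add: N_def Suc)
    show ?thesis
      unfolding N A B by (simp add: Suc)
  qed (simp add: N_def)
  have "degree (Determinant.det S) \<le> n * (n - 1)"
    unfolding det_def'[OF S]
  proof (rule degree_sum_le)
    fix p assume "p \<in> {p. p permutes {0..<N}}"
    then have p: "p permutes {0..<N}" by simp
    have "degree (signof p * (\<Prod>i = 0..<N. S $$ (i, p i))) \<le> degree (\<Prod>i = 0..<N. S $$ (i, p i))"
      by (simp add: sign_def)
    also have "\<dots> \<le> n * (n - 1)"
    \<comment> \<open>The weight bound concerns nonzero entries; a zero entry kills the whole
      product.\<close>
    proof (cases "\<exists>i<N. S $$ (i, p i) = 0")
      case True
      then have "(\<Prod>i = 0..<N. S $$ (i, p i)) = 0" by (auto intro!: prod_zero)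
      then show ?thesis by (simp only: degree_0)
    next
      case False
      have "(\<Sum>i=0..<N. degree (S $$ (i, p i)) + e i) \<le> (\<Sum>i=0..<N. p i)"
        using False permutes_in_image[OF p] by (intro sum_mono entry) auto
      also have "(\<Sum>i=0..<N. p i) = (\<Sum>j<N. j)"
        using sum.permute[OF p, of "\<lambda>j. j"] by (simp add: comp_def lessThan_atLeast0)
      finally have "(\<Sum>i=0..<N. degree (S $$ (i, p i))) \<le> n * (n - 1)"
        using sum_e by (simp add: sum.distrib lessThan_atLeast0)
      moreover have "degree (\<Prod>i = 0..<N. S $$ (i, p i)) \<le> (\<Sum>i=0..<N. degree (S $$ (i, p i)))"
        using degree_prod_sum_le[of "{0..<N}" "\<lambda>i. S $$ (i, p i)"] by (simp add: comp_def)
      ultimately show ?thesis by simp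
    qed
    finally show "degree (signof p * (\<Prod>i = 0..<N. S $$ (i, p i))) \<le> n * (n - 1)" .
  qed (use finite_permutations in auto)
  then show ?thesis by (simp add: resultant_def S_def)
qed

text \<open>A common prime factor \<open>p\<close> of \<open>f\<close> and \<open>f'\<close> divides
  \<open>f\<close> only once, so by the product rule it divides \<open>p'\<close>. In characteristic
  zero \<open>p\<close> is then constant in the outer variable, hence divides the leading
  coefficient and is a unit.\<close>

lemma squarefree_resultant_pderiv_nonzero:
  fixes f :: "complex poly poly poly"
  assumes sf: "squarefree f" and lc: "is_unit (lead_coeff f)"
  shows "resultant f (pderiv f) \<noteq> 0"
proof -
  have [simp]: "f \<noteq> 0" using sf by auto
  have "is_unit (gcd f (pderiv f))"
  proof (rule ccontr)
    assume "\<not> is_unit (gcd f (pderiv f))"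
    moreover have "gcd f (pderiv f) \<noteq> 0" by simp
    ultimately obtain p where p: "prime p" "p dvd gcd f (pderiv f)"
      using prime_divisor_exists[of "gcd f (pderiv f)"] by blast
    then have pf: "p dvd f" and pd: "p dvd pderiv f" by auto
    obtain q where q: "f = p * q" using pf by blast
    have "\<not> p dvd q"
    proof
      assume "p dvd q"
      then have "p ^ 2 dvd f" by (auto simp: q power2_eq_square)
      then show False using sf p by (auto dest!: squarefreeD)
    qed
    moreover have "p dvd q * pderiv p"
      using pd unfolding q pderiv_mult by (simp add: dvd_add_right_iff)
    ultimately have "p dvd pderiv p"
      using p by (auto simp: prime_dvd_mult_iff)
    then have "degree p \<le> degree p - 1" if "degree p \<noteq> 0"
      using divides_degree[of p "pderiv p"] that
      by (auto simp: Polynomial.degree_pderiv pderiv_eq_0_iff)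
    then have "degree p = 0" by linarith
    then obtain a where a: "p = [:a:]" by (rule degree_eq_zeroE)
    have "a dvd lead_coeff f"
      unfolding q a using lead_coeff_mult[of "[:a:]" q] by simp
    then have "is_unit a" using lc dvd_trans by blast
    then have "is_unit p" by (simp add: a is_unit_const_poly_iff)
    then show False using p by auto
  qed
  then have "degree (gcd f (pderiv f)) = 0"
    by (elim is_unit_polyE) simp
  then show ?thesis by (simp add: resultant_0_gcd)
qed

lemma degree_ge_double_roots:
  fixes r :: "'a::idom poly"
  assumes r: "r \<noteq> 0" and S: "finite S" "\<And>y. y \<in> S \<Longrightarrow> [:-y, 1:] ^ 2 dvd r"
  shows "2 * card S \<le> degree r"
proof -
  have o: "order y r \<ge> 2" if "y \<in> S" for y
    using S(2)[OF that] r unfolding order_divides by simp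
  have "2 * card S = (\<Sum>y\<in>S. 2)" by simp
  also have "\<dots> \<le> (\<Sum>y\<in>S. count (proots r) y)"
    using o r by (intro sum_mono) simp
  also have "\<dots> \<le> (\<Sum>y\<in>set_mset (proots r). count (proots r) y)"
    using o r by (intro sum_mono2) (force simp: order_root)+
  also have "\<dots> = size (proots r)" by (simp add: size_multiset_overloaded_eq)
  also have "\<dots> \<le> degree r" by (rule size_proots_le)
  finally show ?thesis .
qed

text \<open>
  The cofactor \<open>b\<close> of \<open>\<phi>'\<close> vanishes at a double root of \<open>\<phi>\<close> because
  \<open>\<phi>\<close> vanishes there to higher order than \<open>\<phi>'\<close>.
\<close>

lemma root_of_cofactor:
  fixes \<phi> :: "'a::field_char_0 poly"
  assumes "\<phi> \<noteq> 0" "poly \<phi> z = 0" "a * \<phi> + b * pderiv \<phi> = 0"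
  shows "poly b z = 0"
proof -
  have d: "pderiv \<phi> \<noteq> 0"
  proof
    assume "pderiv \<phi> = 0"
    then obtain c where "\<phi> = [:c:]" by (auto simp: pderiv_eq_0_iff elim: degree_eq_zeroE)
    then show False using assms by simp
  qed
  show ?thesis
  proof (cases "b = 0")
    case False
    have eq: "b * pderiv \<phi> = - a * \<phi>" using assms by (simp add: add_eq_0_iff)
    then have nz: "a * \<phi> \<noteq> 0" using False d by auto
    have "order z b + order z (pderiv \<phi>) = order z (b * pderiv \<phi>)"
      using False d by (simp add: order_mult)
    also have "\<dots> = order z a + order z \<phi>"
      using nz unfolding eq by (simp add: order_mult)
    also have "order z \<phi> = Suc (order z (pderiv \<phi>))"
      using assms d by (intro order_pderiv) (auto simp: order_root)
    finally have "order z b \<noteq> 0" by linarith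
    then show ?thesis by (simp add: order_root)
  qed simp
qed

section \<open>Singular points and double roots of the discriminant\<close>

definition derivation :: "('a::comm_ring_1 \<Rightarrow> 'a) \<Rightarrow> bool" where
  "derivation D \<longleftrightarrow> (\<forall>a b. D (a + b) = D a + D b) \<and> (\<forall>a b. D (a * b) = D a * b + a * D b)"

lemma derivation_pderiv: "derivation (pderiv :: 'a::idom poly \<Rightarrow> _)"
  by (simp add: derivation_def pderiv_add pderiv_mult mult.commute)

text \<open>A coefficient of a product is a sum of products of coefficients, so the Leibniz rule
  passes from coefficients to polynomials. Iterating this gives the partial derivatives in the inner
  variables.\<close>

lemma derivation_map_poly:
  assumes "derivation D"
  shows "derivation (map_poly D)"
proof -
  have add: "D (a + b) = D a + D b" and mult: "D (a * b) = D a * b + a * D b" for a b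
    using assms by (auto simp: derivation_def)
  have 0: "D 0 = 0" using add[of 0 0] by simp
  have sum: "D (sum f A) = (\<Sum>a\<in>A. D (f a))" for f :: "nat \<Rightarrow> _" and A
    by (induction A rule: infinite_finite_induct) (simp_all add: 0 add)
  show ?thesis
    unfolding derivation_def
    by (auto intro!: poly_eqI simp: coeff_map_poly 0 add coeff_mult sum mult sum.distrib)
qed

lemma derivation_partials: "derivation partial_x" "derivation partial_y" "derivation partial_z"
  unfolding partial_x_def partial_y_def partial_z_def
  by (intro derivation_map_poly derivation_pderiv)+

lemma partials_generators:
  "partial_x (const3 c) = 0" "partial_y (const3 c) = 0" "partial_z (const3 c) = 0"
  "partial_x var_x = 1" "partial_y var_x = 0" "partial_z var_x = 0"
  "partial_x var_y = 0" "partial_y var_y = 1" "partial_z var_y = 0"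
  "partial_x var_z = 0" "partial_y var_z = 0" "partial_z var_z = 1"
  by ((cases "c = 0"; simp add: partial_x_def partial_y_def partial_z_def map_poly_pCons pderiv_pCons map_poly_1)+)

definition line3 :: "complex ^ 3 \<Rightarrow> complex ^ 3 \<Rightarrow> poly3 \<Rightarrow> complex poly" where
  "line3 v w = ev3 (\<lambda>c. [:c:]) [:v $ 1, w $ 1:] [:v $ 2, w $ 2:] [:v $ 3, w $ 3:]"

lemma comm_ring_hom_line3: "comm_ring_hom (line3 v w)"
  unfolding line3_def by (intro comm_ring_hom_ev3 comm_ring_hom_pCons)

lemma poly_line3: "poly (line3 v w F) t = eval3 F (v + t *s w)"
  unfolding line3_def
  by (subst hom_ev3[OF comm_ring_hom_poly comm_ring_hom_pCons]) (simp add: eval3_eq_ev3)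

lemma line3_eqI:
  assumes "\<And>t. eval3 F (v + t *s w) = poly p t"
  shows "line3 v w F = p"
  by (rule iffD1[OF poly_eq_poly_eq_iff], rule ext) (simp add: assms poly_line3)

text \<open>The chain rule: both sides are additive and obey the same product rule in
  \<open>F\<close>, so agreement on generators suffices.\<close>

lemma pderiv_line3:
  "pderiv (line3 v w F) = line3 v w (partial_x F) * [:w $ 1:] + line3 v w (partial_y F) * [:w $ 2:]
     + line3 v w (partial_z F) * [:w $ 3:]"
proof -
  interpret l: comm_ring_hom "line3 v w" by (rule comm_ring_hom_line3)
  note d = derivation_partials[unfolded derivation_def]
  note gen = ev3_generators[OF comm_ring_hom_pCons]
  show ?thesis
  proof (induction F rule: poly3_induct)
    case (add F G)
    then show ?case using d by (simp add: l.hom_add pderiv_add algebra_simps)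
  next
    case (mult F G)
    then show ?case using d by (simp add: l.hom_add l.hom_mult pderiv_mult algebra_simps)
  qed (simp_all only: partials_generators l.hom_zero l.hom_one,
      simp_all only: line3_def gen, simp_all add: pderiv_pCons)
qed

text \<open>Vanishing to second order along every line through \<open>v\<close>. In this form a
  linear change of coordinates only moves lines to lines, and no partial derivative has to be
  transformed.\<close>

definition singular_vector :: "poly3 \<Rightarrow> complex ^ 3 \<Rightarrow> bool" where
  "singular_vector F v \<longleftrightarrow>
     (\<forall>w. poly (line3 v w F) 0 = 0 \<and> poly (pderiv (line3 v w F)) 0 = 0)"

lemma singular_vectorI:
  assumes "eval3 F v = 0" "eval3 (partial_x F) v = 0" "eval3 (partial_y F) v = 0"
    "eval3 (partial_z F) v = 0"
  shows "singular_vector F v"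
  using assms by (auto simp: singular_vector_def pderiv_line3 poly_line3)

lemma singular_vector_eval3: "singular_vector F v \<Longrightarrow> eval3 F v = 0"
  by (auto simp: singular_vector_def poly_line3)

lemma singular_vector_pderiv:
  assumes "singular_vector F v"
  shows "eval3 (pderiv F) v = 0"
proof -
  have "poly (pderiv (line3 v (vector [0, 0, 1]) F)) 0 = 0"
    using assms by (auto simp: singular_vector_def)
  then show ?thesis by (simp add: pderiv_line3 poly_line3 partial_z_def)
qed

lemma line3_subst3: "line3 v w (subst3 M F) = line3 (M *v v) (M *v w) F"
  unfolding line3_def ev3_subst3[OF comm_ring_hom_pCons]
  by (simp add: matrix_vector_mult_def sum_3 mult.commute)

lemma singular_vector_subst3: "singular_vector F (M *v v) \<Longrightarrow> singular_vector (subst3 M F) v"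
  by (auto simp: singular_vector_def line3_subst3)

text \<open>The line through \<open>c *s v\<close> in direction \<open>w\<close> is \<open>c\<close>
  times the line through \<open>v\<close> in direction \<open>w / c\<close>, and homogeneity
  extracts the factor \<open>c ^ n\<close>.\<close>

lemma singular_vector_scale:
  assumes F: "homogeneous3 n F" and v: "singular_vector F v" and c: "c \<noteq> 0"
  shows "singular_vector F (c *s v)"
proof -
  have "line3 (c *s v) w F = [:c:] ^ n * line3 v ((1 / c) *s w) F" for w
  proof -
    have "line3 (c *s v) w F = ev3 (\<lambda>c. [:c:]) ([:c:] * [:v $ 1, w $ 1 / c:]) ([:c:] * [:v $ 2, w $ 2 / c:])
       ([:c:] * [:v $ 3, w $ 3 / c:]) F"
      using c by (simp add: line3_def mult.commute)
    also have "\<dots> = [:c:] ^ n * line3 v ((1 / c) *s w) F"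
      by (subst ev3_homogeneous[OF comm_ring_hom_pCons F]) (simp add: line3_def mult.commute)
    finally show ?thesis .
  qed
  then have "line3 (c *s v) w F = Polynomial.smult (c ^ n) (line3 v ((1 / c) *s w) F)" for w
    by (simp add: poly_const_pow)
  then show ?thesis using v by (auto simp: singular_vector_def pderiv_smult)
qed

text \<open>The discriminant \<open>R\<close> is specialised to a polynomial \<open>r\<close> in
  \<open>y\<close> by setting \<open>x = x0\<close>. Rescaled to first coordinate \<open>x0\<close>,
  each singular vector yields a double root of \<open>r\<close>, and different vectors of
  \<open>P\<close> yield different roots.\<close>

lemma card_singular_vectors_le:
  fixes G :: poly3
  assumes hom: "homogeneous3 n G" and n: "n \<ge> 1" and sf: "squarefree G"
    and lc: "coeff (coeff (coeff G n) 0) 0 \<noteq> 0"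
    and P: "finite P" "\<And>v. v \<in> P \<Longrightarrow> v $ 1 \<noteq> 0" "\<And>v. v \<in> P \<Longrightarrow> singular_vector G v"
      "inj_on (\<lambda>v. v $ 2 / v $ 1) P"
  shows "2 * card P \<le> n * (n - 1)"
proof -
  define c where "c = coeff (coeff (coeff G n) 0) 0"
  have idx: "coeff (coeff (coeff G k) j) i \<noteq> 0 \<Longrightarrow> i + j + k = n" for i j k
    using hom by (auto simp: homogeneous3_def)
  have dk: "degree (coeff G k) + k \<le> n" if "coeff G k \<noteq> 0" for k
  proof -
    have "lead_coeff (lead_coeff (coeff G k)) \<noteq> 0" using that by simp
    then show ?thesis using idx[of k "degree (coeff G k)"] by fastforce
  qed
  have degG: "degree G = n"
  proof (rule antisym)
    show "degree G \<le> n"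
      using dk by (intro degree_le) (metis add_leE linorder_not_less)
    show "n \<le> degree G" using lc by (intro le_degree) auto
  qed
  \<comment> \<open>Total degree \<open>n\<close> leaves no room for \<open>x\<close> or
    \<open>y\<close> beside \<open>z ^ n\<close>.\<close>
  have lcG: "coeff G n = [:[:c:]:]"
  proof (intro poly_eqI)
    fix j i show "coeff (coeff (coeff G n) j) i = coeff (coeff [:[:c:]:] j) i"
      using idx[of n j i] by (cases j; cases i) (auto simp: c_def)
  qed
  have c: "c \<noteq> 0" using lc by (simp add: c_def)
  define R where "R = resultant G (pderiv G)"
  have "is_unit (lead_coeff G)"
    using c by (simp add: degG lcG is_unit_const_poly_iff dvd_field_iff)
  then have R0: "R \<noteq> 0"
    unfolding R_def by (rule squarefree_resultant_pderiv_nonzero[OF sf])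
  have degR: "degree R \<le> n * (n - 1)"
    unfolding R_def by (rule degree_resultant_pderiv_le[OF degG dk])
  obtain A B where AB: "[:R:] = A * G + B * pderiv G"
    using resultant_in_ideal[of G "pderiv G"] n by (auto simp: R_def degG)
  \<comment> \<open>The value \<open>x0\<close> must keep the leading term of \<open>R\<close>
    alive, so that \<open>r\<close> is nonzero, and must itself be nonzero, so that vectors can be
    rescaled to it.\<close>
  have "finite {x. poly (lead_coeff R * [:0, 1:]) x = 0}"
    using R0 by (intro poly_roots_finite) auto
  then obtain x0 where x0: "poly (lead_coeff R * [:0, 1:]) x0 \<noteq> 0"
    using ex_new_if_finite[OF infinite_UNIV_char_0] by blast
  have x0': "x0 \<noteq> 0" "poly (lead_coeff R) x0 \<noteq> 0" using x0 by auto
  define r where "r = map_poly (\<lambda>q. poly q x0) R"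
  have "coeff r (degree R) \<noteq> 0" using x0' by (simp add: r_def coeff_map_poly)
  then have r0: "r \<noteq> 0" by auto
  have degr: "degree r \<le> n * (n - 1)"
    using degR degree_map_poly_le[of "\<lambda>q. poly q x0" R] by (simp add: r_def)
  have evR: "eval3 [:R:] v = poly r (v $ 2)" if "v $ 1 = x0" for v
    using poly_hom.poly_map_poly[of x0 R "[:v $ 2:]"] that by (simp add: eval3_def r_def)
  have double_root: "[:-(x0 * (v $ 2 / v $ 1)), 1:] ^ 2 dvd r" if v: "v \<in> P" for v
  proof -
    define V where "V = (x0 / v $ 1) *s v"
    define y where "y = V $ 2"
    define z where "z = V $ 3"
    have V: "V $ 1 = x0" "y = x0 * (v $ 2 / v $ 1)"
      using P(2)[OF v] by (auto simp: V_def y_def)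
    have sV: "singular_vector G V"
      unfolding V_def using v P x0' by (intro singular_vector_scale[OF hom]) auto
    define e where "e = (vector [0, 0, 1] :: complex ^ 3)"
    define V0 where "V0 = (vector [x0, y, 0] :: complex ^ 3)"
    have V0: "V0 + z *s e = V"
      by (simp add: V0_def e_def Finite_Cartesian_Product.vec_eq_iff forall_3 V(1) y_def z_def)
    \<comment> \<open>The restriction of \<open>G\<close> to the fibre of the projection through
      \<open>V\<close>, with \<open>z\<close> as parameter.\<close>
    define \<phi> where "\<phi> = line3 V0 e G"
    interpret l: comm_ring_hom "line3 V0 e" by (rule comm_ring_hom_line3)
    have \<phi>': "pderiv \<phi> = line3 V0 e (pderiv G)"
      by (simp add: \<phi>_def pderiv_line3 e_def partial_z_def)
    have \<phi>_z: "poly \<phi> z = 0" "poly (pderiv \<phi>) z = 0"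
      using singular_vector_eval3[OF sV] singular_vector_pderiv[OF sV]
      by (simp_all only: \<phi>') (simp_all add: \<phi>_def poly_line3 V0)
    \<comment> \<open>\<open>R\<close> does not involve \<open>z\<close>, so it is constant on the
      fibre; this constant is 0, as \<open>\<phi>\<close> and its derivative vanish at
      \<open>z\<close>. What remains is the relation required by
      \<open>root_of_cofactor\<close>.\<close>
    have lineR: "line3 V0 e [:R:] = [:poly r y:]"
      by (rule line3_eqI) (simp add: evR V0_def e_def)
    have comb: "[:poly r y:] = line3 V0 e A * \<phi> + line3 V0 e B * pderiv \<phi>"
      unfolding lineR[symmetric] AB \<phi>' unfolding \<phi>_def by (simp only: l.hom_add l.hom_mult)
    have "poly [:poly r y:] z = 0" unfolding comb by (simp add: \<phi>_z)
    then have ry: "poly r y = 0" by simp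
    have \<phi>0: "\<phi> \<noteq> 0"
    proof -
      define h where "h = (\<lambda>q :: complex poly poly. poly (poly q [:y:]) x0)"
      interpret h: comm_ring_hom h
        unfolding h_def by (rule comm_ring_hom_comp[OF comm_ring_hom_poly comm_ring_hom_poly])
      have "\<phi> = map_poly h G"
        unfolding \<phi>_def
      proof (rule line3_eqI)
        fix t
        have "h [:[:t:]:] = t" by (simp add: h_def)
        then show "eval3 G (V0 + t *s e) = poly (map_poly h G) t"
          using h.poly_map_poly[of G "[:[:t:]:]"] by (simp add: eval3_def h_def V0_def e_def)
      qed
      then have "coeff \<phi> n = h (coeff G n)" by simp
      then have "coeff \<phi> n = c" by (simp add: lcG h_def)
      then show ?thesis using c by auto
    qed
    have "line3 V0 e A * \<phi> + line3 V0 e B * pderiv \<phi> = 0"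
      by (simp only: comb[symmetric] ry pCons_0_0)
    then have "poly (line3 V0 e B) z = 0"
      by (rule root_of_cofactor[OF \<phi>0 \<phi>_z(1)])
    then have BV: "eval3 B V = 0" by (simp add: poly_line3 V0)
    \<comment> \<open>Now \<open>V\<close> is left in the \<open>y\<close> direction, where
      \<open>R\<close> becomes \<open>r\<close> shifted by \<open>y\<close>. Along this line
      \<open>G\<close> vanishes to second order, and \<open>B\<close> and \<open>pderiv G\<close> to
      first order each.\<close>
    define e' where "e' = (vector [0, 1, 0] :: complex ^ 3)"
    interpret m: comm_ring_hom "line3 V e'" by (rule comm_ring_hom_line3)
    have "line3 V e' [:R:] = pcompose r [:y, 1:]"
      by (rule line3_eqI) (simp add: evR V(1) e'_def poly_pcompose y_def add.commute)
    then have rcomb: "pcompose r [:y, 1:] = line3 V e' A * line3 V e' G + line3 V e' B * line3 V e' (pderiv G)"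
      unfolding AB by (simp add: m.hom_add m.hom_mult)
    have dvd0: "[:0, 1:] dvd p" if "poly p 0 = 0" for p :: "complex poly"
      using that poly_eq_0_iff_dvd[of p 0] by simp
    have "[:0, 1:] dvd line3 V e' B" "[:0, 1:] dvd line3 V e' (pderiv G)"
      by (rule dvd0, simp add: poly_line3 BV singular_vector_pderiv[OF sV])+
    then have "[:0, 1:] ^ 2 dvd line3 V e' B * line3 V e' (pderiv G)"
      unfolding power2_eq_square by (rule mult_dvd_mono)
    moreover have "[:0, 1:] ^ 2 dvd line3 V e' G"
    proof (cases "line3 V e' G = 0")
      case False
      have s: "poly (line3 V e' G) 0 = 0" "poly (pderiv (line3 V e' G)) 0 = 0"
        using sV unfolding singular_vector_def by blast+
      have "pderiv (line3 V e' G) \<noteq> 0"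
      proof
        assume "pderiv (line3 V e' G) = 0"
        then obtain a where "line3 V e' G = [:a:]" by (auto simp: pderiv_eq_0_iff elim: degree_eq_zeroE)
        then show False using False s(1) by simp
      qed
      then have "order 0 (pderiv (line3 V e' G)) \<noteq> 0" using s(2) by (simp add: order_root)
      moreover have "order 0 (line3 V e' G) = Suc (order 0 (pderiv (line3 V e' G)))"
        using False s(1) by (rule order_pderiv)
      ultimately have "2 \<le> order 0 (line3 V e' G)" by simp
      then show ?thesis using order_divides[of 0 2 "line3 V e' G"] by simp
    qed simp
    ultimately have "[:0, 1:] ^ 2 dvd pcompose r [:y, 1:]"
      unfolding rcomb by (intro dvd_add dvd_mult[of _ "line3 V e' G"])
    then have "pcompose ([:0, 1:] ^ 2) [:-y, 1:] dvd pcompose (pcompose r [:y, 1:]) [:-y, 1:]"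
      by (rule pcompose_hom.hom_dvd)
    then have "[:-y, 1:] ^ 2 dvd r"
      using pcompose_idR[of r] by (simp add: pcompose_assoc[symmetric] pcompose_pCons pcompose_hom.hom_power)
    then show ?thesis by (simp only: V(2))
  qed
  have "2 * card ((\<lambda>v. x0 * (v $ 2 / v $ 1)) ` P) \<le> degree r"
    using P(1) double_root by (intro degree_ge_double_roots r0) auto
  moreover have "inj_on (\<lambda>v. x0 * (v $ 2 / v $ 1)) P"
    using P(4) unfolding inj_on_def mult_left_cancel[OF x0'(1)] .
  ultimately show ?thesis using degr by (simp add: card_image)
qed

section \<open>The number of singular points\<close>

lemma homogeneous3_0: "homogeneous3 n 0"
  by (simp add: homogeneous3_def)

lemma homogeneous3_add: "homogeneous3 n F \<Longrightarrow> homogeneous3 n G \<Longrightarrow> homogeneous3 n (F + G)"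
  by (simp add: homogeneous3_def) (metis add_0)

lemma homogeneous3_sum: "(\<And>x. x \<in> A \<Longrightarrow> homogeneous3 n (f x)) \<Longrightarrow> homogeneous3 n (sum f A)"
  by (induction A rule: infinite_finite_induct) (auto intro: homogeneous3_add homogeneous3_0)

lemma homogeneous3_mult:
  assumes "homogeneous3 m F" "homogeneous3 n G"
  shows "homogeneous3 (m + n) (F * G)"
  unfolding homogeneous3_def
proof (intro allI impI)
  fix i j k assume "coeff (coeff (coeff (F * G) k) j) i \<noteq> 0"
  then have "(\<Sum>k'\<le>k. \<Sum>j'\<le>j. \<Sum>i'\<le>i. coeff (coeff (coeff F k') j') i' *
      coeff (coeff (coeff G (k - k')) (j - j')) (i - i')) \<noteq> 0"
    by (simp add: coeff_mult coeff_sum)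
  then obtain k' where k': "k' \<le> k" "(\<Sum>j'\<le>j. \<Sum>i'\<le>i. coeff (coeff (coeff F k') j') i' *
      coeff (coeff (coeff G (k - k')) (j - j')) (i - i')) \<noteq> 0"
    by (auto elim: sum.not_neutral_contains_not_neutral)
  then obtain j' where j': "j' \<le> j" "(\<Sum>i'\<le>i. coeff (coeff (coeff F k') j') i' *
      coeff (coeff (coeff G (k - k')) (j - j')) (i - i')) \<noteq> 0"
    by (auto elim: sum.not_neutral_contains_not_neutral)
  then obtain i' where i': "i' \<le> i" "coeff (coeff (coeff F k') j') i' *
      coeff (coeff (coeff G (k - k')) (j - j')) (i - i') \<noteq> 0"
    by (auto elim: sum.not_neutral_contains_not_neutral)
  then have "i' + j' + k' = m" "(i - i') + (j - j') + (k - k') = n"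
    using assms unfolding homogeneous3_def mult_eq_0_iff de_Morgan_disj by blast+
  then show "i + j + k = m + n" using i' j' k' by linarith
qed

lemma homogeneous3_const3: "homogeneous3 0 (const3 c)"
  by (auto simp: homogeneous3_def coeff_pCons split: nat.splits)

lemma homogeneous3_linear_form: "homogeneous3 1 (linear_form c)"
  by (auto simp: homogeneous3_def linear_form_def coeff_pCons split: nat.splits)

lemma homogeneous3_power:
  assumes "homogeneous3 m F" shows "homogeneous3 (k * m) (F ^ k)"
proof (induction k)
  case 0
  show ?case using homogeneous3_const3[of 1] by (simp add: pCons_one)
next
  case (Suc k)
  then show ?case using homogeneous3_mult[OF assms] by simp
qed

lemma homogeneous3_subst3:
  assumes "homogeneous3 n F"
  shows "homogeneous3 n (subst3 M F)"
proof -
  let ?L = "\<lambda>i. linear_form (M $ i)"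
  have "homogeneous3 n (const3 (coeff (coeff (coeff F k) j) i) * ?L 1 ^ i * ?L 2 ^ j * ?L 3 ^ k)"
    for i j k
  proof (cases "coeff (coeff (coeff F k) j) i = 0")
    case False
    then have "n = 0 + i * 1 + j * 1 + k * 1" using assms by (auto simp: homogeneous3_def)
    then show ?thesis
      by (simp only:) (intro homogeneous3_mult homogeneous3_power homogeneous3_const3 homogeneous3_linear_form)
  qed (simp add: homogeneous3_0)
  then show ?thesis
    unfolding subst3_def ev3_altdef[OF comm_ring_hom_const3] sum_distrib_right
    by (intro homogeneous3_sum)
qed

lemma eval3_scale: "homogeneous3 n F \<Longrightarrow> eval3 F (c *s v) = c ^ n * eval3 F v"
  by (simp add: eval3_eq_ev3 ev3_homogeneous[OF comm_ring_hom_id])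

text \<open>At \<open>(0, 0, 1)\<close> only pure powers of \<open>z\<close> contribute, and
  homogeneity leaves \<open>z ^ n\<close> alone.\<close>

lemma leading_coeff_homogeneous3:
  assumes G: "homogeneous3 n G" and nz: "eval3 G (vector [0, 0, 1]) \<noteq> 0"
  shows "coeff (coeff (coeff G n) 0) 0 \<noteq> 0"
proof -
  have "eval3 G (vector [0, 0, 1]) = (\<Sum>k\<le>degree G. coeff (coeff (coeff G k) 0) 0)"
    by (simp add: eval3_def pCons_one poly_0_coeff_0 poly_altdef[of G] coeff_sum)
  then obtain k where "coeff (coeff (coeff G k) 0) 0 \<noteq> 0"
    using nz by (auto elim: sum.not_neutral_contains_not_neutral)
  moreover from this have "k = n" using G by (force simp: homogeneous3_def)
  ultimately show ?thesis by simp
qed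

section \<open>Points in general position\<close>

lemma exists_poly_nonzero:
  fixes p :: "'a::idom poly" and g :: "complex \<Rightarrow> 'a"
  assumes "p \<noteq> 0" "inj g"
  shows "\<exists>a. poly p (g a) \<noteq> 0"
proof (rule ccontr)
  assume "\<not> ?thesis"
  then have "range g \<subseteq> {x. poly p x = 0}" by auto
  then have "finite (range g)" using poly_roots_finite[OF assms(1)] finite_subset by blast
  then show False using assms(2) finite_imageD infinite_UNIV_char_0 by blast
qed

text \<open>The variables are specialised one at a time, from the outermost inwards, each time to a
  complex constant avoiding finitely many roots.\<close>

lemma eval3_nonvanishing:
  assumes "F \<noteq> 0" shows "\<exists>v. eval3 F v \<noteq> 0"
proof -
  obtain c where c: "poly F [:[:c:]:] \<noteq> 0"
    using exists_poly_nonzero[OF assms, of "\<lambda>c. [:[:c:]:]"] by (auto simp: inj_def)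
  obtain b where b: "poly (poly F [:[:c:]:]) [:b:] \<noteq> 0"
    using exists_poly_nonzero[OF c, of "\<lambda>b. [:b:]"] by (auto simp: inj_def)
  obtain a where a: "poly (poly (poly F [:[:c:]:]) [:b:]) a \<noteq> 0"
    using exists_poly_nonzero[OF b, of "\<lambda>a. a"] by auto
  then show ?thesis by (intro exI[of _ "vector [a, b, c]"]) (simp add: eval3_def)
qed

text \<open>The coefficients of the linear form \<open>r \<mapsto> det (p, q, r)\<close>, which for
  independent \<open>p\<close> and \<open>q\<close> is the equation of the line joining
  them.\<close>

definition cross :: "complex ^ 3 \<Rightarrow> complex ^ 3 \<Rightarrow> complex ^ 3" where
  "cross p q = vector [p $ 2 * q $ 3 - p $ 3 * q $ 2, p $ 3 * q $ 1 - p $ 1 * q $ 3,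
     p $ 1 * q $ 2 - p $ 2 * q $ 1]"

lemma det_eq_cross: "det (vector [p, q, r]) = eval3 (linear_form (cross p q)) r"
  by (simp add: det_3 eval3_def linear_form_def cross_def algebra_simps)

lemma cross_eq_0D:
  assumes "cross p q = 0" "p \<noteq> 0"
  shows "\<exists>c. q = c *s p"
proof -
  have e: "p $ 2 * q $ 3 = p $ 3 * q $ 2" "p $ 3 * q $ 1 = p $ 1 * q $ 3" "p $ 1 * q $ 2 = p $ 2 * q $ 1"
    using assms by (auto simp: cross_def Finite_Cartesian_Product.vec_eq_iff forall_3)
  consider "p $ 1 \<noteq> 0" | "p $ 2 \<noteq> 0" | "p $ 3 \<noteq> 0"
    using assms by (auto simp: Finite_Cartesian_Product.vec_eq_iff forall_3)
  then show ?thesis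
  proof cases
    case 1
    then show ?thesis using e
      by (intro exI[of _ "q $ 1 / p $ 1"]) (simp add: Finite_Cartesian_Product.vec_eq_iff forall_3 field_simps)
  next
    case 2
    then show ?thesis using e
      by (intro exI[of _ "q $ 2 / p $ 2"]) (simp add: Finite_Cartesian_Product.vec_eq_iff forall_3 field_simps)
  next
    case 3
    then show ?thesis using e
      by (intro exI[of _ "q $ 3 / p $ 3"]) (simp add: Finite_Cartesian_Product.vec_eq_iff forall_3 field_simps)
  qed
qed

text \<open>The product of \<open>F\<close> with all the linear forms is nonzero in an integral
  domain, so it has a nonzero value.\<close>

lemma exists_generic_vector:
  assumes "F \<noteq> 0" "finite C" "0 \<notin> C"
  shows "\<exists>v. eval3 F v \<noteq> 0 \<and> (\<forall>c\<in>C. eval3 (linear_form c) v \<noteq> 0)"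
proof -
  have "F * (\<Prod>c\<in>C. linear_form c) \<noteq> 0"
    using assms by (auto simp: linear_form_eq_0_iff)
  then obtain v where v: "eval3 (F * (\<Prod>c\<in>C. linear_form c)) v \<noteq> 0"
    using eval3_nonvanishing by blast
  interpret e: comm_ring_hom "\<lambda>F. eval3 F v" by (rule comm_ring_hom_eval3)
  from v show ?thesis using assms(2) by (auto simp: e.hom_mult e.hom_prod)
qed

lemma proj_point_scale:
  assumes "c \<noteq> 0"
  shows "proj_point (c *s v) = proj_point v"
proof -
  have "k *s v \<in> range (\<lambda>k. k *s (c *s v))" for k
    by (rule range_eqI[of _ _ "k / c"]) (use assms in simp)
  moreover have "k *s (c *s v) \<in> range (\<lambda>k. k *s v)" for k
    by (rule range_eqI[of _ _ "k * c"]) simp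
  ultimately show ?thesis
    unfolding proj_point_def vec.span_singleton by blast
qed

text \<open>Coordinates are chosen with the centre of projection \<open>ctr\<close> at
  \<open>(0, 0, 1)\<close> and the line through \<open>w\<close> and \<open>ctr\<close> as
  \<open>x = 0\<close>, to meet the position required by
  \<open>card_singular_vectors_le\<close>.\<close>

theorem card_Sing_le:
  assumes F: "reduced_plane_curve n F"
  shows "2 * card (Sing F) \<le> n * (n - 1)"
\<comment> \<open>For an empty or infinite set \<open>card\<close> is 0 and the bound is
  trivial.\<close>
proof (cases "finite (Sing F) \<and> Sing F \<noteq> {}")
  case True
  have n: "n \<ge> 1" and hom: "homogeneous3 n F" and sf: "squarefree F"
    using F by (auto simp: reduced_plane_curve_def)
  have F0: "F \<noteq> 0" using sf by auto
  have "\<exists>v. v \<noteq> 0 \<and> singular_vector F v \<and> P = proj_point v" if "P \<in> Sing F" for P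
    using that unfolding Sing_def by (auto intro: singular_vectorI)
  then obtain rep where rep: "\<And>P. P \<in> Sing F \<Longrightarrow> rep P \<noteq> 0 \<and> singular_vector F (rep P) \<and> P = proj_point (rep P)"
    by metis
  define V where "V = rep ` Sing F"
  have inj_rep: "inj_on rep (Sing F)" using rep by (metis inj_onI)
  have V: "finite V" "V \<noteq> {}" "card V = card (Sing F)"
    using True by (auto simp: V_def card_image inj_rep)
  have sV: "singular_vector F p" "p \<noteq> 0" if "p \<in> V" for p
  proof -
    obtain P where P: "P \<in> Sing F" "p = rep P" using \<open>p \<in> V\<close> by (auto simp: V_def)
    show "singular_vector F p" "p \<noteq> 0" unfolding P(2) using rep[OF P(1)] by blast+
  qed
  have cr: "cross p q \<noteq> 0" if pq: "p \<in> V" "q \<in> V" "p \<noteq> q" for p q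
  proof
    assume "cross p q = 0"
    then obtain c where c: "q = c *s p" using cross_eq_0D sV pq by blast
    then have "c \<noteq> 0" using sV[OF pq(2)] by auto
    then have "proj_point q = proj_point p" by (simp add: c proj_point_scale)
    moreover obtain P Q where "P \<in> Sing F" "p = rep P" "Q \<in> Sing F" "q = rep Q"
      using pq by (auto simp: V_def)
    ultimately show False using pq(3) rep by metis
  qed
  \<comment> \<open>The lines joining two singular points. The centre \<open>ctr\<close> is taken
    off these and off the curve, so that no two singular points have the same projection.\<close>
  define C where "C = (\<lambda>(p, q). cross p q) ` {(p, q) \<in> V \<times> V. p \<noteq> q}"
  have "finite C" unfolding C_def
    by (rule finite_imageI, rule finite_subset[of _ "V \<times> V"]) (use V(1) in auto)
  moreover have "0 \<notin> C" using cr by (force simp: C_def)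
  ultimately obtain ctr where ctr: "eval3 F ctr \<noteq> 0" "\<And>c. c \<in> C \<Longrightarrow> eval3 (linear_form c) ctr \<noteq> 0"
    using exists_generic_vector[OF F0, of C] by blast
  have ctr_det: "det (vector [p, q, ctr]) \<noteq> 0" if "p \<in> V" "q \<in> V" "p \<noteq> q" for p q
    unfolding det_eq_cross using that by (intro ctr(2)) (auto simp: C_def)
  have crO: "cross p ctr \<noteq> 0" if pV: "p \<in> V" for p
  proof
    assume "cross p ctr = 0"
    then obtain c where "ctr = c *s p" using cross_eq_0D sV pV by blast
    then show False using ctr(1) singular_vector_eval3[OF sV(1)[OF pV]] by (simp add: eval3_scale[OF hom])
  qed
  \<comment> \<open>The point \<open>w\<close> avoids the lines joining \<open>ctr\<close> to
    singular points, so the line through \<open>w\<close> and \<open>ctr\<close> contains no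
    singular point.\<close>
  have "finite ((\<lambda>p. cross p ctr) ` V)" "0 \<notin> (\<lambda>p. cross p ctr) ` V"
    using V(1) crO by auto
  then obtain w where "\<And>c. c \<in> (\<lambda>p. cross p ctr) ` V \<Longrightarrow> eval3 (linear_form c) w \<noteq> 0"
    using exists_generic_vector[OF F0, of "(\<lambda>p. cross p ctr) ` V"] by blast
  then have w: "det (vector [p, ctr, w]) \<noteq> 0" if "p \<in> V" for p
    unfolding det_eq_cross using that by blast
  obtain u where u: "u \<in> V" using V by auto
  define M where "M = (transpose (vector [u, w, ctr]) :: complex ^ 3 ^ 3)"
  have Mv: "M *v x = x $ 1 *s u + x $ 2 *s w + x $ 3 *s ctr" for x
    by (simp add: M_def matrix_vector_mult_def transpose_def sum_3 Finite_Cartesian_Product.vec_eq_iff mult.commute)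
  have detswap: "det (vector [p, w, ctr]) = - det (vector [p, ctr, w])" for p :: "complex ^ 3"
    by (simp add: det_3 algebra_simps)
  have "det M \<noteq> 0" using w[OF u] by (simp add: M_def det_transpose detswap)
  then have invM: "invertible M" by (simp add: invertible_det_nz)
  then obtain N where N: "M ** N = mat 1" by (auto simp: invertible_def)
  have MN: "M *v (N *v p) = p" for p
    by (simp add: matrix_vector_mul_assoc N)
  define P where "P = (\<lambda>p. N *v p) ` V"
  have cardP: "card P = card V"
    unfolding P_def using MN by (intro card_image inj_on_inverseI[of _ "\<lambda>p. M *v p"]) auto
  have PV: "M *v x \<in> V" if "x \<in> P" for x
    using that MN by (auto simp: P_def)
  have x1: "x $ 1 \<noteq> 0" if "x \<in> P" for x
  proof -
    have "det (vector [M *v x, w, ctr]) = x $ 1 * det (vector [u, w, ctr])"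
      by (simp add: Mv det_3 algebra_simps)
    then show ?thesis using w[OF PV[OF that]] detswap by auto
  qed
  have inj: "inj_on (\<lambda>x. x $ 2 / x $ 1) P"
  proof (rule inj_onI)
    fix x y assume xy: "x \<in> P" "y \<in> P" "x $ 2 / x $ 1 = y $ 2 / y $ 1"
    \<comment> \<open>Equal projections would make the two singular points collinear with
      \<open>ctr\<close>.\<close>
    have "det (vector [M *v x, M *v y, ctr]) = (x $ 1 * y $ 2 - x $ 2 * y $ 1) * det (vector [u, w, ctr])"
      by (simp add: Mv det_3 algebra_simps)
    also have "x $ 1 * y $ 2 - x $ 2 * y $ 1 = 0" using xy x1 by (simp add: field_simps)
    finally have "M *v x = M *v y" using ctr_det[OF PV[OF xy(1)] PV[OF xy(2)]] by auto
    then show "x = y" using xy(1,2) MN by (auto simp: P_def)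
  qed
  have "eval3 (subst3 M F) (vector [0, 0, 1]) = eval3 F ctr" by (simp add: eval3_subst3 Mv)
  then have "2 * card P \<le> n * (n - 1)"
    using ctr(1) V(1) sV(1)[OF PV] x1
    by (intro card_singular_vectors_le[of n "subst3 M F"] homogeneous3_subst3 hom n squarefree_subst3 invM sf inj
        leading_coeff_homogeneous3 singular_vector_subst3) (auto simp: P_def)
  then show ?thesis by (simp add: cardP V)
qed auto

section \<open>Quadratic parts\<close>

text \<open>Complex differentiability at the single parameter 0 is demanded, a class of curves
  preserved by maps that fix the origin and are complex differentiable there.\<close>

definition germ_curve :: "(complex \<Rightarrow> complex \<times> complex) \<Rightarrow> complex \<times> complex \<Rightarrow> bool" where
  "germ_curve c h \<longleftrightarrow>
     c 0 = (0, 0) \<and> (c has_derivative (\<lambda>s. (s * fst h, s * snd h))) (at 0)"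

text \<open>
  The quadratic part is read off along curves through the origin rather than from second
  derivatives: this way a change of coordinates enters only through its first derivative.
\<close>

definition quadratic_part ::
  "(complex \<times> complex \<Rightarrow> complex) \<Rightarrow> (complex \<times> complex \<Rightarrow> complex) \<Rightarrow> bool" where
  "quadratic_part f Q \<longleftrightarrow>
     (\<forall>c h. germ_curve c h \<longrightarrow> ((\<lambda>s. f (c s) / s ^ 2) \<longlongrightarrow> Q h) (at 0))"

text \<open>For a quadratic form this says that the radical is nontrivial. Phrased by translations
  it makes sense for any function and is visibly invariant under additive bijections.\<close>

definition degenerate :: "(complex \<times> complex \<Rightarrow> complex) \<Rightarrow> bool" where
  "degenerate Q \<longleftrightarrow> (\<exists>h. h \<noteq> 0 \<and> (\<forall>k. Q (k + h) = Q k))"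

lemma germ_curve_line: "germ_curve (\<lambda>s. (s * fst h, s * snd h)) h"
  unfolding germ_curve_def by (auto intro!: derivative_eq_intros)

lemma germ_curve_tendsto:
  assumes "germ_curve c h"
  shows "((\<lambda>s. fst (c s) / s) \<longlongrightarrow> fst h) (at 0)" "((\<lambda>s. snd (c s) / s) \<longlongrightarrow> snd h) (at 0)"
    "(c \<longlongrightarrow> (0, 0)) (at 0)"
proof -
  have c: "c 0 = (0, 0)" "(c has_derivative (\<lambda>s. (s * fst h, s * snd h))) (at 0)"
    using assms by (auto simp: germ_curve_def)
  have "((\<lambda>s. fst (c s)) has_field_derivative fst h) (at 0)"
    unfolding has_field_derivative_def
    by (rule has_derivative_eq_rhs[OF has_derivative_fst[OF c(2)]]) (simp add: fun_eq_iff)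
  then show "((\<lambda>s. fst (c s) / s) \<longlongrightarrow> fst h) (at 0)"
    by (simp add: DERIV_def c(1))
  have "((\<lambda>s. snd (c s)) has_field_derivative snd h) (at 0)"
    unfolding has_field_derivative_def
    by (rule has_derivative_eq_rhs[OF has_derivative_snd[OF c(2)]]) (simp add: fun_eq_iff)
  then show "((\<lambda>s. snd (c s) / s) \<longlongrightarrow> snd h) (at 0)"
    by (simp add: DERIV_def c(1))
  show "(c \<longlongrightarrow> (0, 0)) (at 0)"
    using has_derivative_continuous[OF c(2)] by (simp add: continuous_within c(1))
qed

lemma quadratic_part_unique:
  assumes "quadratic_part f Q" "quadratic_part f Q'"
  shows "Q = Q'"
proof
  fix h
  show "Q h = Q' h"
    using assms germ_curve_line[of h] unfolding quadratic_part_def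
    by (blast intro: tendsto_unique[OF at_neq_bot])
qed

text \<open>The map \<open>\<phi>\<close> sends a germ curve with tangent \<open>h\<close> to one
  whose tangent is the image of \<open>h\<close> under the derivative, and the factor
  \<open>u\<close> enters only through its value at the origin.\<close>

lemma quadratic_part_pullback:
  assumes g: "quadratic_part g Q" and \<phi>0: "\<phi> (0, 0) = (0, 0)"
    and \<phi>: "(\<phi> has_derivative (\<lambda>h. (a\<^sub>1 * fst h + b\<^sub>1 * snd h, a\<^sub>2 * fst h + b\<^sub>2 * snd h))) (at (0, 0))"
    and u: "isCont u (0, 0)"
    and eq: "eventually (\<lambda>p. f p = u p * g (\<phi> p)) (nhds (0, 0))"
  shows "quadratic_part f (\<lambda>h. u (0, 0) * Q (a\<^sub>1 * fst h + b\<^sub>1 * snd h, a\<^sub>2 * fst h + b\<^sub>2 * snd h))"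
  unfolding quadratic_part_def
proof (intro allI impI)
  fix c h assume c: "germ_curve c h"
  let ?L = "\<lambda>h. (a\<^sub>1 * fst h + b\<^sub>1 * snd h, a\<^sub>2 * fst h + b\<^sub>2 * snd h)"
  have c0: "c 0 = (0, 0)" and dc: "(c has_derivative (\<lambda>s. (s * fst h, s * snd h))) (at 0)"
    using c by (auto simp: germ_curve_def)
  have "((\<lambda>s. \<phi> (c s)) has_derivative (\<lambda>s. ?L (s * fst h, s * snd h))) (at 0)"
    using \<phi> by (intro has_derivative_compose[OF dc]) (simp add: c0)
  then have "germ_curve (\<lambda>s. \<phi> (c s)) (?L h)"
    by (simp add: germ_curve_def c0 \<phi>0 algebra_simps)
  then have "((\<lambda>s. g (\<phi> (c s)) / s ^ 2) \<longlongrightarrow> Q (?L h)) (at 0)"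
    using g by (auto simp: quadratic_part_def)
  moreover have "((\<lambda>s. u (c s)) \<longlongrightarrow> u (0, 0)) (at 0)"
    using germ_curve_tendsto(3)[OF c] u by (rule isCont_tendsto_compose[rotated])
  ultimately have "((\<lambda>s. u (c s) * (g (\<phi> (c s)) / s ^ 2)) \<longlongrightarrow> u (0, 0) * Q (?L h)) (at 0)"
    by (intro tendsto_mult)
  moreover have "eventually (\<lambda>s. f (c s) = u (c s) * g (\<phi> (c s))) (at 0)"
    using eq germ_curve_tendsto(3)[OF c] by (rule eventually_compose_filterlim)
  then have "eventually (\<lambda>s. u (c s) * (g (\<phi> (c s)) / s ^ 2) = f (c s) / s ^ 2) (at 0)"
    by eventually_elim simp
  ultimately show "((\<lambda>s. f (c s) / s ^ 2) \<longlongrightarrow> u (0, 0) * Q (?L h)) (at 0)"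
    by (rule Lim_transform_eventually)
qed

lemma degenerate_pullback:
  assumes "u \<noteq> 0" "bij L" "\<And>h k. L (h + k) = L h + L k"
  shows "degenerate (\<lambda>h. u * Q (L h)) \<longleftrightarrow> degenerate Q"
proof -
  have L0: "L h = 0 \<longleftrightarrow> h = 0" for h
  proof -
    have "L 0 = 0" using assms(3)[of 0 0] by simp
    then show ?thesis using assms(2) by (metis bij_def injD)
  qed
  have "(\<exists>h. h \<noteq> 0 \<and> (\<forall>k. Q (L k + L h) = Q (L k))) \<longleftrightarrow> (\<exists>h. h \<noteq> 0 \<and> (\<forall>k. Q (k + h) = Q k))"
    using assms(2) L0 by (metis bij_pointE)
  then show ?thesis using assms(1) by (simp add: degenerate_def assms(3))
qed

fun quadratic_normal_form :: "ade_type \<Rightarrow> complex \<times> complex \<Rightarrow> complex" where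
  "quadratic_normal_form (type_A k) (x, y) = (if k = 1 then x ^ 2 + y ^ 2 else x ^ 2)"
| "quadratic_normal_form _ _ = 0"

text \<open>Two factors of each monomial absorb \<open>s ^ 2\<close> and converge to coordinates of
  the tangent; any further factors tend to 0.\<close>

lemma quadratic_part_ade_normal_form:
  assumes "valid_ade T"
  shows "quadratic_part (ade_normal_form T) (quadratic_normal_form T)"
  unfolding quadratic_part_def
proof (intro allI impI)
  fix c h assume c: "germ_curve c h"
  obtain h1 h2 where h: "h = (h1, h2)" by (cases h)
  define x where "x s = fst (c s)" for s
  define y where "y s = snd (c s)" for s
  have cs: "c s = (x s, y s)" for s by (simp add: x_def y_def)
  have X: "((\<lambda>s. x s / s) \<longlongrightarrow> h1) (at 0)" and Y: "((\<lambda>s. y s / s) \<longlongrightarrow> h2) (at 0)"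
    using germ_curve_tendsto[OF c] by (simp_all add: x_def y_def h)
  have x: "(x \<longlongrightarrow> 0) (at 0)" and y: "(y \<longlongrightarrow> 0) (at 0)"
    using tendsto_fst[OF germ_curve_tendsto(3)[OF c]] tendsto_snd[OF germ_curve_tendsto(3)[OF c]]
    by (simp_all add: x_def[abs_def] y_def[abs_def])
  have split: "b ^ (m + 2) / s ^ 2 = (b / s) ^ 2 * b ^ m" for b s :: complex and m
    by (simp add: power_add power_divide power2_eq_square)
  show "((\<lambda>s. ade_normal_form T (c s) / s ^ 2) \<longlongrightarrow> quadratic_normal_form T h) (at 0)"
  proof (cases T)
    case (type_A k)
    then have "k - 1 + 2 = k + 1" using assms by simp
    then have "ade_normal_form T (c s) / s ^ 2 = (x s / s) ^ 2 + (y s / s) ^ 2 * y s ^ (k - 1)" for s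
      using split[of "y s" "k - 1" s] by (simp add: type_A cs add_divide_distrib power_divide)
    \<comment> \<open>The power \<open>0 ^ (k - 1)\<close> is 1 for \<open>k = 1\<close> and 0 for
      larger \<open>k\<close>, which singles out the node.\<close>
    moreover have "quadratic_normal_form T h = h1 ^ 2 + h2 ^ 2 * 0 ^ (k - 1)"
      using assms by (auto simp: type_A h)
    ultimately show ?thesis by (simp only:) (intro tendsto_intros X Y y)
  next
    case (type_D k)
    then have k: "k - 3 + 2 = k - 1" "k - 3 > 0" using assms by auto
    then have "ade_normal_form T (c s) / s ^ 2 = (x s / s) ^ 2 * y s + (y s / s) ^ 2 * y s ^ (k - 3)" for s
      using split[of "y s" "k - 3" s] by (simp add: type_D cs add_divide_distrib power_divide)
    moreover have "quadratic_normal_form T h = h1 ^ 2 * 0 + h2 ^ 2 * 0 ^ (k - 3)"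
      using k by (simp add: type_D)
    ultimately show ?thesis by (simp only:) (intro tendsto_intros X Y y)
  next
    case type_E6
    then have "ade_normal_form T (c s) / s ^ 2 = (x s / s) ^ 2 * x s ^ 1 + (y s / s) ^ 2 * y s ^ 2" for s
      using split[of "y s" 2 s] split[of "x s" 1 s] by (simp add: cs add_divide_distrib power3_eq_cube mult_ac)
    moreover have "quadratic_normal_form T h = h1 ^ 2 * 0 ^ 1 + h2 ^ 2 * 0 ^ 2" by (simp add: type_E6)
    ultimately show ?thesis by (simp only:) (intro tendsto_intros X Y x y)
  next
    case type_E7
    then have "ade_normal_form T (c s) / s ^ 2 = (x s / s) ^ 2 * x s + (x s / s) * (y s / s) * y s ^ 2" for s
      by (simp add: cs add_divide_distrib power2_eq_square power3_eq_cube mult_ac)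
    moreover have "quadratic_normal_form T h = h1 ^ 2 * 0 + h1 * h2 * 0 ^ 2" by (simp add: type_E7)
    ultimately show ?thesis by (simp only:) (intro tendsto_intros X Y x y)
  next
    case type_E8
    then have "ade_normal_form T (c s) / s ^ 2 = (x s / s) ^ 2 * x s ^ 1 + (y s / s) ^ 2 * y s ^ 3" for s
      using split[of "y s" 3 s] split[of "x s" 1 s] by (simp add: cs add_divide_distrib power3_eq_cube mult_ac)
    moreover have "quadratic_normal_form T h = h1 ^ 2 * 0 ^ 1 + h2 ^ 2 * 0 ^ 3" by (simp add: type_E8)
    ultimately show ?thesis by (simp only:) (intro tendsto_intros X Y x y)
  qed
qed

text \<open>All forms other than that of \<open>type_A 1\<close> are independent of
  \<open>y\<close>, hence invariant under translation by \<open>(0, 1)\<close>. For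
  \<open>x ^ 2 + y ^ 2\<close>, three values of \<open>k\<close> force the translation to be
  zero.\<close>

lemma degenerate_quadratic_normal_form:
  "degenerate (quadratic_normal_form T) \<longleftrightarrow> T \<noteq> type_A 1"
proof (cases "T = type_A 1")
  case True
  have "h = 0" if "\<And>k. quadratic_normal_form (type_A 1) (k + h) = quadratic_normal_form (type_A 1) k" for h
  proof (cases h)
    case (Pair x y)
    have "x ^ 2 + y ^ 2 = 0" "(1 + x) ^ 2 + y ^ 2 = 1" "x ^ 2 + (1 + y) ^ 2 = 1"
      using that[of "(0, 0)"] that[of "(1, 0)"] that[of "(0, 1)"] by (simp_all add: Pair)
    moreover have "2 * x = ((1 + x) ^ 2 + y ^ 2) - (x ^ 2 + y ^ 2) - 1"
      "2 * y = (x ^ 2 + (1 + y) ^ 2) - (x ^ 2 + y ^ 2) - 1"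
      by (simp_all add: power2_eq_square algebra_simps)
    ultimately have "2 * x = 0" "2 * y = 0" by simp_all
    then show ?thesis by (simp add: Pair zero_prod_def)
  qed
  then show ?thesis using True by (auto simp: degenerate_def)
next
  case False
  have "quadratic_normal_form T (k + (0, 1)) = quadratic_normal_form T k" for k
    using False by (cases T; cases k) auto
  then show ?thesis using False unfolding degenerate_def
    by (intro iffI exI[of _ "(0, 1)"]) (auto simp: zero_prod_def)
qed

section \<open>Invariance under analytic equivalence and change of chart\<close>

lemma holomorphic2_map_derivative:
  assumes "holomorphic2_on (fst \<circ> \<phi>) U" "holomorphic2_on (snd \<circ> \<phi>) U" "p \<in> U"
  shows "\<exists>a\<^sub>1 b\<^sub>1 a\<^sub>2 b\<^sub>2. (\<phi> has_derivative
    (\<lambda>h. (a\<^sub>1 * fst h + b\<^sub>1 * snd h, a\<^sub>2 * fst h + b\<^sub>2 * snd h))) (at p)"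
proof -
  obtain a\<^sub>1 b\<^sub>1 a\<^sub>2 b\<^sub>2 where
    "((fst \<circ> \<phi>) has_derivative (\<lambda>h. a\<^sub>1 * fst h + b\<^sub>1 * snd h)) (at p)"
    "((snd \<circ> \<phi>) has_derivative (\<lambda>h. a\<^sub>2 * fst h + b\<^sub>2 * snd h)) (at p)"
    using assms unfolding holomorphic2_on_def by blast
  from has_derivative_Pair[OF this] show ?thesis by (auto simp: comp_def)
qed

text \<open>By the chain rule the derivatives of \<open>\<phi>\<close> and \<open>\<psi>\<close> at
  the origin are mutually inverse, so the quadratic part changes by a linear bijection and the
  nonzero factor \<open>u (0, 0)\<close>.\<close>

lemma quadratic_part_equivalent:
  assumes eq: "locally_analytically_equivalent f g" and g: "quadratic_part g Q"
  shows "\<exists>Q'. quadratic_part f Q' \<and> (degenerate Q' \<longleftrightarrow> degenerate Q)"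
proof -
  obtain U V \<phi> \<psi> u where bih: "biholomorphism U V \<phi> \<psi>" and 0: "(0, 0) \<in> U" "\<phi> (0, 0) = (0, 0)"
    and u: "holomorphic2_on u U" "\<And>p. p \<in> U \<Longrightarrow> u p \<noteq> 0 \<and> f p = u p * g (\<phi> p)"
    using eq unfolding locally_analytically_equivalent_def by blast
  have UV: "open U" "open V" and hom: "homeomorphism U V \<phi> \<psi>"
    using bih unfolding biholomorphism_def by blast+
  note inv = homeomorphism_apply1[OF hom] homeomorphism_apply2[OF hom]
  have V0: "(0, 0) \<in> V"
    using homeomorphism_image1[OF hom] 0 by (metis imageI)
  have \<psi>0: "\<psi> (0, 0) = (0, 0)" using inv(1)[OF 0(1)] 0(2) by simp
  define L where "L a\<^sub>1 b\<^sub>1 a\<^sub>2 b\<^sub>2 = (\<lambda>h. (a\<^sub>1 * fst h + b\<^sub>1 * snd h, a\<^sub>2 * fst h + b\<^sub>2 * snd h))"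
    for a\<^sub>1 b\<^sub>1 a\<^sub>2 b\<^sub>2 :: complex
  obtain a\<^sub>1 b\<^sub>1 a\<^sub>2 b\<^sub>2 where \<phi>: "(\<phi> has_derivative L a\<^sub>1 b\<^sub>1 a\<^sub>2 b\<^sub>2) (at (0, 0))"
    using holomorphic2_map_derivative[of \<phi> U "(0, 0)"] bih 0 unfolding biholomorphism_def L_def by blast
  obtain c\<^sub>1 d\<^sub>1 c\<^sub>2 d\<^sub>2 where \<psi>: "(\<psi> has_derivative L c\<^sub>1 d\<^sub>1 c\<^sub>2 d\<^sub>2) (at (0, 0))"
    using holomorphic2_map_derivative[of \<psi> V "(0, 0)"] bih V0 unfolding biholomorphism_def L_def by blast
  have "((\<lambda>p. \<psi> (\<phi> p)) has_derivative (\<lambda>h. L c\<^sub>1 d\<^sub>1 c\<^sub>2 d\<^sub>2 (L a\<^sub>1 b\<^sub>1 a\<^sub>2 b\<^sub>2 h))) (at (0, 0))"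
    using \<psi> by (intro has_derivative_compose[OF \<phi>]) (simp add: 0)
  moreover have "((\<lambda>p. \<psi> (\<phi> p)) has_derivative (\<lambda>h. h)) (at (0, 0))"
    by (rule has_derivative_transform_within_open[OF has_derivative_ident UV(1) 0(1)]) (simp add: inv)
  ultimately have 1: "(\<lambda>h. L c\<^sub>1 d\<^sub>1 c\<^sub>2 d\<^sub>2 (L a\<^sub>1 b\<^sub>1 a\<^sub>2 b\<^sub>2 h)) = (\<lambda>h. h)"
    by (rule has_derivative_unique)
  have "((\<lambda>p. \<phi> (\<psi> p)) has_derivative (\<lambda>h. L a\<^sub>1 b\<^sub>1 a\<^sub>2 b\<^sub>2 (L c\<^sub>1 d\<^sub>1 c\<^sub>2 d\<^sub>2 h))) (at (0, 0))"
    using \<phi> by (intro has_derivative_compose[OF \<psi>]) (simp add: \<psi>0)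
  moreover have "((\<lambda>p. \<phi> (\<psi> p)) has_derivative (\<lambda>h. h)) (at (0, 0))"
    by (rule has_derivative_transform_within_open[OF has_derivative_ident UV(2) V0]) (simp add: inv)
  ultimately have 2: "(\<lambda>h. L a\<^sub>1 b\<^sub>1 a\<^sub>2 b\<^sub>2 (L c\<^sub>1 d\<^sub>1 c\<^sub>2 d\<^sub>2 h)) = (\<lambda>h. h)"
    by (rule has_derivative_unique)
  have bij: "bij (L a\<^sub>1 b\<^sub>1 a\<^sub>2 b\<^sub>2)"
    using 1 2 by (intro o_bij[of "L c\<^sub>1 d\<^sub>1 c\<^sub>2 d\<^sub>2"]) (auto simp: fun_eq_iff)
  have "isCont u (0, 0)"
    using u(1) 0(1) unfolding holomorphic2_on_def by (blast intro: has_derivative_continuous)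
  moreover have "eventually (\<lambda>p. f p = u p * g (\<phi> p)) (nhds (0, 0))"
    using UV(1) 0(1) u(2) by (auto simp: eventually_nhds)
  ultimately have "quadratic_part f (\<lambda>h. u (0, 0) * Q (L a\<^sub>1 b\<^sub>1 a\<^sub>2 b\<^sub>2 h))"
    unfolding L_def using g 0(2) \<phi>[unfolded L_def] by (intro quadratic_part_pullback)
  moreover have "degenerate (\<lambda>h. u (0, 0) * Q (L a\<^sub>1 b\<^sub>1 a\<^sub>2 b\<^sub>2 h)) \<longleftrightarrow> degenerate Q"
    using u(2)[OF 0(1)] bij by (intro degenerate_pullback) (auto simp: L_def algebra_simps)
  ultimately show ?thesis by blast
qed

lemma frame_spans:
  fixes v a b w :: "complex ^ 3"
  assumes "det (vector [v, a, b] :: complex ^ 3 ^ 3) \<noteq> 0"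
  shows "\<exists>x y z. w = x *s v + y *s a + z *s b"
proof -
  define M where "M = (transpose (vector [v, a, b]) :: complex ^ 3 ^ 3)"
  have Mv: "M *v x = x $ 1 *s v + x $ 2 *s a + x $ 3 *s b" for x
    by (simp add: M_def matrix_vector_mult_def transpose_def sum_3 Finite_Cartesian_Product.vec_eq_iff mult.commute)
  have "invertible M" using assms by (simp add: invertible_det_nz M_def det_transpose)
  then obtain N where "M ** N = mat 1" by (auto simp: invertible_def)
  then have "M *v (N *v w) = w" by (simp add: matrix_vector_mul_assoc)
  then show ?thesis unfolding Mv by metis
qed

text \<open>Two charts centred at the same point differ by a fractional linear map, and by
  homogeneity the equations differ by the \<open>n\<close>-th power of its denominator.\<close>

lemma quadratic_part_chart_change:
  assumes F: "homogeneous3 n F"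
    and fr: "det (vector [v, a, b] :: complex ^ 3 ^ 3) \<noteq> 0"
    and fr': "det (vector [l *s v, a', b'] :: complex ^ 3 ^ 3) \<noteq> 0"
    and Q: "quadratic_part (local_equation F v a b) Q"
  shows "\<exists>Q'. quadratic_part (local_equation F (l *s v) a' b') Q' \<and> (degenerate Q' \<longleftrightarrow> degenerate Q)"
proof -
  obtain a0 a1 a2 where a': "a' = a0 *s v + a1 *s a + a2 *s b" using frame_spans[OF fr] by blast
  obtain b0 b1 b2 where b': "b' = b0 *s v + b1 *s a + b2 *s b" using frame_spans[OF fr] by blast
  define D where "D = a1 * b2 - a2 * b1"
  have "det (vector [l *s v, a', b'] :: complex ^ 3 ^ 3) = l * D * det (vector [v, a, b] :: complex ^ 3 ^ 3)"
    by (simp add: a' b' D_def det_3 algebra_simps)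
  then have l: "l \<noteq> 0" and D: "D \<noteq> 0" using fr' by auto
  \<comment> \<open>The coefficient of \<open>v\<close> in
    \<open>l *s v + s *s a' + t *s b'\<close>; it is the common denominator and equals
    \<open>l\<close> at the origin.\<close>
  define c where "c p = l + a0 * fst p + b0 * snd p" for p :: "complex \<times> complex"
  define \<phi> where "\<phi> p = ((a1 * fst p + b1 * snd p) / c p, (a2 * fst p + b2 * snd p) / c p)" for p
  define L where "L h = (a1 / l * fst h + b1 / l * snd h, a2 / l * fst h + b2 / l * snd h)"
    for h :: "complex \<times> complex"
  have cont: "isCont c (0, 0)" unfolding c_def by (intro continuous_intros)
  have d\<phi>: "(\<phi> has_derivative L) (at (0, 0))"
    unfolding \<phi>_def L_def c_def using l by (auto intro!: derivative_eq_intros simp: field_simps)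
  have "eventually (\<lambda>p. c p \<noteq> 0) (nhds (0, 0))"
    using cont[unfolded isCont_def tendsto_at_iff_tendsto_nhds] l
    by (intro tendsto_imp_eventually_ne[of c "c (0, 0)"]) (auto simp: c_def)
  then have ev: "eventually (\<lambda>p. local_equation F (l *s v) a' b' p = c p ^ n * local_equation F v a b (\<phi> p)) (nhds (0, 0))"
  proof eventually_elim
    case (elim p)
    obtain s t where p: "p = (s, t)" by (cases p)
    have "c p * fst (\<phi> p) = a1 * s + b1 * t" "c p * snd (\<phi> p) = a2 * s + b2 * t"
      using elim by (simp_all add: \<phi>_def p)
    moreover have "c p *s (v + fst (\<phi> p) *s a + snd (\<phi> p) *s b) =
        c p *s v + (c p * fst (\<phi> p)) *s a + (c p * snd (\<phi> p)) *s b"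
      by (simp add: Finite_Cartesian_Product.vec_eq_iff algebra_simps)
    ultimately have eq: "l *s v + s *s a' + t *s b' = c p *s (v + fst (\<phi> p) *s a + snd (\<phi> p) *s b)"
      by (simp add: a' b' c_def p Finite_Cartesian_Product.vec_eq_iff algebra_simps)
    have "local_equation F (l *s v) a' b' p = eval3 F (l *s v + s *s a' + t *s b')"
      by (simp add: local_equation_def p)
    also have "\<dots> = c p ^ n * eval3 F (v + fst (\<phi> p) *s a + snd (\<phi> p) *s b)"
      unfolding eq by (rule eval3_scale[OF F])
    finally show ?case by (simp add: local_equation_def case_prod_unfold)
  qed
  have \<phi>0: "\<phi> (0, 0) = (0, 0)" by (simp add: \<phi>_def)
  have cont': "isCont (\<lambda>p. c p ^ n) (0, 0)" using cont by (rule continuous_power)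
  have "quadratic_part (local_equation F (l *s v) a' b') (\<lambda>h. c (0, 0) ^ n * Q (L h))"
    unfolding L_def by (rule quadratic_part_pullback[OF Q \<phi>0 d\<phi>[unfolded L_def] cont' ev])
  moreover have "degenerate (\<lambda>h. c (0, 0) ^ n * Q (L h)) \<longleftrightarrow> degenerate Q"
  proof (rule degenerate_pullback)
    \<comment> \<open>The inverse of \<open>L\<close> by Cramer's rule.\<close>
    define K where "K h = (l * (b2 * fst h - b1 * snd h) / D, l * (a1 * snd h - a2 * fst h) / D)"
      for h :: "complex \<times> complex"
    have L': "L h = ((a1 * fst h + b1 * snd h) / l, (a2 * fst h + b2 * snd h) / l)" for h
      by (simp add: L_def add_divide_distrib)
    have scale: "p * (l * X / D) + q * (l * Y / D) = l * ((p * X + q * Y) / D)"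
      "l * (p * (X / l) - q * (Y / l)) / D = (p * X - q * Y) / D" for p q X Y
      using l by (simp_all add: add_divide_distrib right_diff_distrib algebra_simps)
    have "L (K h) = h" for h
    proof -
      have e: "a1 * (b2 * fst h - b1 * snd h) + b1 * (a1 * snd h - a2 * fst h) = D * fst h"
        "a2 * (b2 * fst h - b1 * snd h) + b2 * (a1 * snd h - a2 * fst h) = D * snd h"
        by (simp_all add: D_def algebra_simps)
      show ?thesis unfolding L' K_def fst_conv snd_conv scale e using l D by simp
    qed
    moreover have "K (L h) = h" for h
    proof -
      have e: "b2 * (a1 * fst h + b1 * snd h) - b1 * (a2 * fst h + b2 * snd h) = D * fst h"
        "a1 * (a2 * fst h + b2 * snd h) - a2 * (a1 * fst h + b1 * snd h) = D * snd h"
        by (simp_all add: D_def algebra_simps)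
      show ?thesis unfolding L' K_def fst_conv snd_conv scale e using l D by simp
    qed
    ultimately show "bij L" by (intro o_bij[of K]) (auto simp: fun_eq_iff)
  qed (use l in \<open>auto simp: c_def L_def algebra_simps add_divide_distrib\<close>)
  ultimately show ?thesis by blast
qed

lemma has_ade_type_quadratic_part:
  assumes "has_ade_type F P T"
  shows "\<exists>v a b Q. P = proj_point v \<and> det (vector [v, a, b] :: complex ^ 3 ^ 3) \<noteq> 0 \<and>
    quadratic_part (local_equation F v a b) Q \<and> (degenerate Q \<longleftrightarrow> T \<noteq> type_A 1)"
proof -
  obtain v a b where vab: "P = proj_point v" "det (vector [v, a, b] :: complex ^ 3 ^ 3) \<noteq> 0"
    "locally_analytically_equivalent (local_equation F v a b) (ade_normal_form T)" "valid_ade T"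
    using assms unfolding has_ade_type_def by blast
  show ?thesis
    using quadratic_part_equivalent[OF vab(3) quadratic_part_ade_normal_form[OF vab(4)]] vab(1,2)
    unfolding degenerate_quadratic_normal_form by blast
qed

text \<open>The two types may be witnessed in different charts. The nondegenerate quadratic part is
  therefore carried to the other chart, where uniqueness of the quadratic part compares it with that
  of \<open>T\<close>.\<close>

lemma ade_type_A1_unique:
  assumes F: "homogeneous3 n F" and T: "has_ade_type F P T" and A: "has_ade_type F P (type_A 1)"
  shows "T = type_A 1"
proof -
  obtain v a b Q where 1: "P = proj_point v" "det (vector [v, a, b] :: complex ^ 3 ^ 3) \<noteq> 0"
    "quadratic_part (local_equation F v a b) Q" "\<not> degenerate Q"
    using has_ade_type_quadratic_part[OF A] by blast
  obtain v' a' b' Q' where 2: "P = proj_point v'" "det (vector [v', a', b'] :: complex ^ 3 ^ 3) \<noteq> 0"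
    "quadratic_part (local_equation F v' a' b') Q'" "degenerate Q' \<longleftrightarrow> T \<noteq> type_A 1"
    using has_ade_type_quadratic_part[OF T] by blast
  have "v' \<in> proj_point v" using 1(1) 2(1) unfolding proj_point_def by (metis insertI1 vec.span_base)
  then obtain l where "v' = l *s v" unfolding proj_point_def vec.span_singleton by blast
  then have "\<not> degenerate Q'"
    using quadratic_part_chart_change[OF F 1(2) _ 1(3)] 1(4) 2(2,3) quadratic_part_unique by metis
  then show ?thesis using 2(4) by blast
qed

section \<open>Counting nodes against the Miyaoka-Kobayashi equality\<close>

lemma mk_number_at_node:
  assumes "homogeneous3 n F" "has_ade_type F P (type_A 1)"
  shows "mk_number_at F P = 9 / 2"
proof -
  have "(THE T. has_ade_type F P T) = type_A 1"
    using assms ade_type_A1_unique by (intro the_equality) blast+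
  then show ?thesis by (simp add: mk_number_at_def mk_number_def)
qed

theorem corollary5p10:
  fixes F :: poly3 and n :: nat
  assumes "reduced_plane_curve n F"
    and "even n"
    and "n \<ge> 8"
    and "nodal F"
  shows "\<not> MK_curve F"
proof
  assume "MK_curve F"
  \<comment> \<open>\<open>MK_curve\<close> quantifies over the degree, so the count is made for the
    degree \<open>d\<close> it supplies.\<close>
  then obtain d where d: "reduced_plane_curve d F" "d \<ge> 6"
    and mk: "mk_number_curve F = real d / 2 * (5 * real d - 6)"
    unfolding MK_curve_def by blast
  have "homogeneous3 d F" using d by (simp add: reduced_plane_curve_def)
  then have "mk_number_curve F = (\<Sum>P\<in>Sing F. 9 / 2)"
    unfolding mk_number_curve_def using \<open>nodal F\<close>
    by (intro sum.cong mk_number_at_node) (auto simp: nodal_def)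
  \<comment> \<open>Were \<open>Sing F\<close> infinite, both the sum and \<open>card\<close> would
    be 0, so the equation holds in every case.\<close>
  then have eq: "9 * real (card (Sing F)) = real d * (5 * real d - 6)" using mk by simp
  have "real (2 * card (Sing F)) \<le> real (d * (d - 1))"
    using card_Sing_le[OF d(1)] by (simp only: of_nat_le_iff)
  then have "2 * real (card (Sing F)) \<le> real d * (real d - 1)" using d(2) by (simp add: of_nat_diff)
  \<comment> \<open>Cancelling \<open>d\<close> would give \<open>d \<le> 3\<close>.\<close>
  then have "real d * (10 * real d - 12) \<le> real d * (9 * real d - 9)" using eq by (simp add: algebra_simps)
  then show False using d(2) by simp
qed

end
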